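(* Let $\mathbf{k}$ be a field of characteristic zero, let $M=\mathbb{Z}^n$, let $S=\mathbb{Z}_{\ge 0}^n$ be the first octant, and let $I$ be a full monomial ideal of $\mathbf{k}[S]$ with cofinite support. Let $T=\operatorname{Spec}\mathbf{k}[M]\subset\operatorname{Aut}_{\mathbf{k}}(\mathbf{k}[S]/I)$. Then the centralizer of $T$ in $\operatorname{Aut}_{\mathbf{k}}(\mathbf{k}[S]/I)$ equals $T$. In particular, $T$ is a maximal torus of $\operatorname{Aut}_{\mathbf{k}}(\mathbf{k}[S]/I)$.
   Context: $\mathbf{k}[S]=\mathbf{k}[x_1,\dots,x_n]$, with $\mathbf{x}^m=x_1^{m_1}\cdots x_n^{m_n}$. A monomial ideal is one generated by finitely many monomials; $\operatorname{supp}(I)=\{m\in S\mid\mathbf{x}^m\in I\}$. $I$ has cofinite support if $S\setminus\operatorname{supp}(I)$ is finite (equivalently, $\mathbf{k}[S]/I$ is finite-dimensional). $I$ is full if no standard basis vector $e_i$ lies in $\operatorname{supp}(I)$, i.e. no variable belongs to $I$. $\operatorname{Aut}_{\mathbf{k}}(\mathbf{k}[S]/I)$ is the group of $\mathbf{k}$-algebra automorphisms; it is a linear algebraic group (closed in $\operatorname{GL}(\mathbf{k}[S]/I)$). A point $t\in T$ corresponds to a homomorphism $t\colon M\to\mathbf{k}^*$ and acts on $\mathbf{k}[S]$ by $\mathbf{x}^m\mapsto t(m)\mathbf{x}^m$; this preserves $I$ and induces a faithful action of $T$ on $\mathbf{k}[S]/I$, via which $T$ is identified with its image in $\operatorname{Aut}_{\mathbf{k}}(\mathbf{k}[S]/I)$.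 *)

theory Defs
  imports
    "HOL-Library.Poly_Mapping"
    "HOL-Algebra.Algebraic_Closure_Type"
    "HOL-Algebra.Bij"
    "HOL-Algebra.QuotRing"
    "HOL-Algebra.Module"
    "Jordan_Normal_Form.Determinant"
begin

section \<open>Algebras and their automorphism groups\<close>

text \<open>
  A \<open>'k\<close>-algebra is a ring record with a scalar multiplication by elements of the type \<open>'k\<close>.
  As for \<^const>\<open>AutoGroup\<close>, automorphisms are extensional functions on the carrier.
\<close>

definition alg_auto :: "('k, 'a) module \<Rightarrow> ('a \<Rightarrow> 'a) set" where
  "alg_auto A = {\<phi> \<in> ring_iso A A \<inter> extensional (carrier A).
     \<forall>c. \<forall>a \<in> carrier A. \<phi> (c \<odot>\<^bsub>A\<^esub> a) = c \<odot>\<^bsub>A\<^esub> \<phi> a}"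

definition alg_AutoGroup :: "('k, 'a) module \<Rightarrow> ('a \<Rightarrow> 'a) monoid" where
  "alg_AutoGroup A = BijGroup (carrier A)\<lparr>carrier := alg_auto A\<rparr>"

definition centralizer :: "('a, 'b) monoid_scheme \<Rightarrow> 'a set \<Rightarrow> 'a set" where
  "centralizer G T = {g \<in> carrier G. \<forall>t \<in> T. g \<otimes>\<^bsub>G\<^esub> t = t \<otimes>\<^bsub>G\<^esub> g}"


section \<open>Algebraic tori in general linear groups\<close>

definition GL :: "nat \<Rightarrow> 'k::field mat monoid" where
  "GL d = units_of (ring_mat TYPE('k) d ())"

text \<open>Polynomials in the entries of a \<open>d \<times> d\<close> matrix; the variables are the index pairs.\<close>

type_synonym 'k entry_poly = "((nat \<times> nat) \<Rightarrow>\<^sub>0 nat) \<Rightarrow>\<^sub>0 'k"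

definition entry_polys :: "nat \<Rightarrow> 'k::field entry_poly set" where
  "entry_polys d = {p. \<forall>m \<in> Poly_Mapping.keys p. Poly_Mapping.keys m \<subseteq> {..<d} \<times> {..<d}}"

text \<open>The map \<open>\<sigma>\<close> is the embedding of the coefficient field into the field of matrix entries.\<close>

definition eval_entries ::
    "('k::field \<Rightarrow> 'l::field) \<Rightarrow> 'k entry_poly \<Rightarrow> 'l mat \<Rightarrow> 'l" where
  "eval_entries \<sigma> p g =
     (\<Sum>m \<in> Poly_Mapping.keys p. \<sigma> (Poly_Mapping.lookup p m) *
        (\<Prod>v \<in> Poly_Mapping.keys m. g $$ v ^ Poly_Mapping.lookup m v))"

definition zero_locus ::
    "('k::field \<Rightarrow> 'l::field) \<Rightarrow> nat \<Rightarrow> 'k entry_poly set \<Rightarrow> 'l mat set" where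
  "zero_locus \<sigma> d P = {g \<in> carrier (GL d). \<forall>p \<in> P. eval_entries \<sigma> p g = 0}"

text \<open>
  The coordinate ring of \<open>GL d\<close> is generated by the matrix entries and the inverse of the
  determinant; the regular functions on a closed subset are the restrictions of its elements.
\<close>

definition regular_on :: "nat \<Rightarrow> 'k::field mat set \<Rightarrow> ('k mat \<Rightarrow> 'k) \<Rightarrow> bool" where
  "regular_on d H f \<longleftrightarrow>
     (\<exists>p \<in> entry_polys d. \<exists>e::nat. \<forall>g \<in> H. f g = eval_entries id p g / det g ^ e)"

definition alg_group_hom ::
    "nat \<Rightarrow> 'k::field mat set \<Rightarrow> nat \<Rightarrow> 'k mat set \<Rightarrow> ('k mat \<Rightarrow> 'k mat) \<Rightarrow> bool" where
  "alg_group_hom d H r H' F \<longleftrightarrow>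
     F \<in> hom (GL d\<lparr>carrier := H\<rparr>) (GL r\<lparr>carrier := H'\<rparr>) \<and>
     (\<forall>i<r. \<forall>j<r. regular_on d H (\<lambda>g. F g $$ (i, j)))"

definition alg_group_isomorphic ::
    "nat \<Rightarrow> 'k::field mat set \<Rightarrow> nat \<Rightarrow> 'k mat set \<Rightarrow> bool" where
  "alg_group_isomorphic d H r H' \<longleftrightarrow>
     (\<exists>F F'. alg_group_hom d H r H' F \<and> alg_group_hom r H' d H F' \<and>
        (\<forall>g \<in> H. F' (F g) = g) \<and> (\<forall>h \<in> H'. F (F' h) = h))"

text \<open>The group \<open>G\<^sub>m\<^sup>r\<close>, realised as the invertible diagonal matrices.\<close>

definition Gm_power :: "nat \<Rightarrow> 'k::field mat set" where
  "Gm_power r = {g \<in> carrier (GL r). diagonal_mat g}"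

text \<open>
  A torus over a field \<open>k\<close>, not necessarily split, is an algebraic group over \<open>k\<close> that becomes
  isomorphic to some \<open>G\<^sub>m\<^sup>r\<close> over the algebraic closure.  The predicate says that \<open>H\<close> is the
  group of \<open>k\<close>-points of a subtorus of \<open>GL d\<close> over \<open>k\<close>: the equations \<open>P\<close> have coefficients in
  \<open>k\<close>, and \<open>H\<close> and the geometric torus are their solutions over \<open>k\<close> and over its closure.
  The definition is meant for perfect infinite \<open>k\<close>, e.g. of characteristic zero: then closed
  subgroups with equations over \<open>k\<close> are defined over \<open>k\<close>, and the \<open>k\<close>-points of a torus are
  dense in it, so that a torus over \<open>k\<close> is determined by its \<open>k\<close>-points and inclusions of tori
  are inclusions of the groups of \<open>k\<close>-points.
\<close>

definition torus_points :: "nat \<Rightarrow> 'k::field mat set \<Rightarrow> bool" where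
  "torus_points d H \<longleftrightarrow>
     (\<exists>P \<subseteq> entry_polys d.
        H = zero_locus id d P \<and>
        subgroup (zero_locus (to_ac :: 'k \<Rightarrow> 'k alg_closure) d P) (GL d) \<and>
        (\<exists>r. alg_group_isomorphic d (zero_locus (to_ac :: 'k \<Rightarrow> 'k alg_closure) d P)
               r (Gm_power r)))"


section \<open>Maximal tori in groups of linear automorphisms\<close>

definition alg_basis :: "('k::field, 'a) module \<Rightarrow> 'a list \<Rightarrow> bool" where
  "alg_basis A bs \<longleftrightarrow> set bs \<subseteq> carrier A \<and>
     (\<forall>a \<in> carrier A. \<exists>!v. v \<in> carrier_vec (length bs) \<and>
        a = (\<Oplus>\<^bsub>A\<^esub> i \<in> {..<length bs}. (v $ i) \<odot>\<^bsub>A\<^esub> (bs ! i)))"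

definition basis_coords :: "('k::field, 'a) module \<Rightarrow> 'a list \<Rightarrow> 'a \<Rightarrow> 'k vec" where
  "basis_coords A bs a = (THE v. v \<in> carrier_vec (length bs) \<and>
     a = (\<Oplus>\<^bsub>A\<^esub> i \<in> {..<length bs}. (v $ i) \<odot>\<^bsub>A\<^esub> (bs ! i)))"

definition matrix_in_basis ::
    "('k::field, 'a) module \<Rightarrow> 'a list \<Rightarrow> ('a \<Rightarrow> 'a) \<Rightarrow> 'k mat" where
  "matrix_in_basis A bs \<phi> =
     mat (length bs) (length bs) (\<lambda>(i, j). basis_coords A bs (\<phi> (bs ! j)) $ i)"

text \<open>
  A basis identifies the linear automorphisms of \<open>A\<close> with \<open>GL d\<close>; changing the basis conjugates
  the matrices, so the choice of the basis does not matter.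
\<close>

definition torus_in ::
    "('k::field, 'a) module \<Rightarrow> ('a \<Rightarrow> 'a) set \<Rightarrow> ('a \<Rightarrow> 'a) set \<Rightarrow> bool" where
  "torus_in A G H \<longleftrightarrow> H \<subseteq> G \<and>
     (\<exists>bs. alg_basis A bs \<and> torus_points (length bs) (matrix_in_basis A bs ` H))"

definition maximal_torus_in ::
    "('k::field, 'a) module \<Rightarrow> ('a \<Rightarrow> 'a) set \<Rightarrow> ('a \<Rightarrow> 'a) set \<Rightarrow> bool" where
  "maximal_torus_in A G T \<longleftrightarrow> torus_in A G T \<and> (\<forall>H. torus_in A G H \<and> T \<subseteq> H \<longrightarrow> H = T)"


section \<open>Monomial ideals of the polynomial ring\<close>

text \<open>
  The variables are indexed by the type \<open>'n\<close>, which is finite where it matters.  Thus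
  \<open>'n \<Rightarrow>\<^sub>0 nat\<close> is the octant \<open>S\<close>, \<open>'n \<Rightarrow>\<^sub>0 int\<close> is the lattice \<open>M\<close>, and the
  type \<open>('n, 'k) octant_poly\<close> is the semigroup algebra of \<open>S\<close> with convolution product.
\<close>

type_synonym ('n, 'k) octant_poly = "('n \<Rightarrow>\<^sub>0 nat) \<Rightarrow>\<^sub>0 'k"

abbreviation monomial :: "('n \<Rightarrow>\<^sub>0 nat) \<Rightarrow> ('n, 'k::field) octant_poly" where
  "monomial m \<equiv> Poly_Mapping.single m 1"

abbreviation octant_ring :: "('n, 'k::field) octant_poly ring" where
  "octant_ring \<equiv> ring_of_type_algebra"

definition monomial_ideal :: "('n, 'k::field) octant_poly set \<Rightarrow> bool" where
  "monomial_ideal I \<longleftrightarrow> (\<exists>F. finite F \<and> I = Idl\<^bsub>octant_ring\<^esub> (monomial ` F))"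

definition ideal_supp :: "('n, 'k::field) octant_poly set \<Rightarrow> ('n \<Rightarrow>\<^sub>0 nat) set" where
  "ideal_supp I = {m. monomial m \<in> I}"

definition cofinite_support :: "('n, 'k::field) octant_poly set \<Rightarrow> bool" where
  "cofinite_support I \<longleftrightarrow> finite (UNIV - ideal_supp I)"

definition full_ideal :: "('n, 'k::field) octant_poly set \<Rightarrow> bool" where
  "full_ideal I \<longleftrightarrow> (\<forall>i. Poly_Mapping.single i 1 \<notin> ideal_supp I)"

definition quot_alg ::
    "('n, 'k::field) octant_poly set \<Rightarrow> ('k, ('n, 'k) octant_poly set) module" where
  "quot_alg I = ring.extend (octant_ring Quot I)
     (module.fields
        (\<lambda>c a. (I +>\<^bsub>octant_ring\<^esub> Poly_Mapping.single 0 c) \<otimes>\<^bsub>octant_ring Quot I\<^esub> a))"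


section \<open>The torus acting on the quotient algebra\<close>

definition lattice_chars :: "(('n \<Rightarrow>\<^sub>0 int) \<Rightarrow> 'k::field) set" where
  "lattice_chars = {t. (\<forall>m. t m \<noteq> 0) \<and> (\<forall>m m'. t (m + m') = t m * t m')}"

definition char_act ::
    "(('n \<Rightarrow>\<^sub>0 int) \<Rightarrow> 'k::field) \<Rightarrow> ('n, 'k) octant_poly \<Rightarrow> ('n, 'k) octant_poly" where
  "char_act t f = Poly_Mapping.mapp (\<lambda>m c. t (Poly_Mapping.map int m) * c) f"

text \<open>
  Since \<open>char_act t\<close> is an automorphism that maps a monomial ideal \<open>I\<close> onto itself, the image of
  the coset of \<open>f\<close> is the coset of \<open>char_act t f\<close>.
\<close>

definition quot_torus ::
    "('n, 'k::field) octant_poly set \<Rightarrow>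
     (('n, 'k) octant_poly set \<Rightarrow> ('n, 'k) octant_poly set) set" where
  "quot_torus I =
     (\<lambda>t. restrict (\<lambda>a. char_act t ` a) (carrier (quot_alg I))) ` lattice_chars"

end

theory Submission
  imports Defs
begin

text \<open>
  Let \<open>A\<close> be the quotient algebra. Its basis consists of the classes of the finitely many monomials
  outside the support of \<open>I\<close>, and each class \<open>x\<^sup>m\<close> is an eigenvector of the torus \<open>T\<close> with character
  \<open>m\<close>. All the arguments come down to the comparison of these characters.

  The centralizer of \<open>T\<close>. An automorphism \<open>\<phi>\<close> that commutes with \<open>T\<close> preserves the weight spaces.
  Different exponents give different characters: the torus element that multiplies one variable by
  \<open>2\<close> and fixes the others reads off one exponent \<open>e\<close> as the scalar \<open>2\<^sup>e\<close>, and in characteristic zero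
  the powers of \<open>2\<close> are distinct. Hence \<open>\<phi>\<close> maps the class of each variable \<open>x\<close> to \<open>c x\<close> times itself.
  Since \<open>I\<close> is full, this class is not zero, so that \<open>c x \<noteq> 0\<close> by injectivity of \<open>\<phi>\<close>. The variables
  generate \<open>A\<close>, so \<open>\<phi>\<close> is the action of the torus element \<open>c\<close>; this is \<open>centralizer_quot_torus\<close>.

  Why \<open>T\<close> is a torus. In the basis of monomials \<open>T\<close> consists of the diagonal matrices with entries
  \<open>c\<^sup>m\<close>. Fullness puts all the variables into the basis, so the values \<open>c x\<close> appear among the diagonal
  entries, and the other entries are monomials in them. This gives equations for \<open>T\<close> over any field
  (\<open>zero_locus_torus_eqs\<close>). Moreover, any two groups of this form, also for different lists of
  monomials, are isomorphic as algebraic groups if both lists contain all the variables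
  (\<open>torus_mats_isomorphic\<close>); the list of the variables alone gives \<open>G\<^sub>m\<^sup>n\<close>.

  Maximality. The points of any torus commute, because they do so over the algebraic closure, where
  the torus is isomorphic to a group of diagonal matrices. A torus that contains \<open>T\<close> therefore lies
  in the centralizer of \<open>T\<close>, which is \<open>T\<close> (\<open>self_centralizing_torus_maximal\<close>).
\<close>

unbundle no fps_syntax


section \<open>Algebras over a field, in coordinates\<close>

lemma type_algebra_simps [simp]:
  "carrier (ring_of_type_algebra :: 'k::comm_ring_1 ring) = UNIV"
  "x \<oplus>\<^bsub>ring_of_type_algebra\<^esub> y = x + (y :: 'k)"
  "x \<otimes>\<^bsub>ring_of_type_algebra\<^esub> y = x * (y :: 'k)"
  "\<zero>\<^bsub>ring_of_type_algebra\<^esub> = (0 :: 'k)"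
  "\<one>\<^bsub>ring_of_type_algebra\<^esub> = (1 :: 'k)"
  by (simp_all add: ring_of_type_algebra_def)

lemma a_minus_type_algebra [simp]:
  "x \<ominus>\<^bsub>ring_of_type_algebra\<^esub> y = x - (y :: 'k::comm_ring_1)"
proof -
  interpret ring "ring_of_type_algebra :: 'k ring" by rule
  have "\<ominus>\<^bsub>ring_of_type_algebra\<^esub> y + y = 0"
    using l_neg[of y] by simp
  then have "\<ominus>\<^bsub>ring_of_type_algebra\<^esub> y = - y"
    by (simp add: eq_neg_iff_add_eq_0)
  then show ?thesis
    by (simp add: a_minus_def)
qed

lemma alg_autoD:
  assumes "\<phi> \<in> alg_auto A"
  shows "\<And>a. a \<in> carrier A \<Longrightarrow> \<phi> a \<in> carrier A"
    and "\<And>a b. a \<in> carrier A \<Longrightarrow> b \<in> carrier A \<Longrightarrow> \<phi> (a \<oplus>\<^bsub>A\<^esub> b) = \<phi> a \<oplus>\<^bsub>A\<^esub> \<phi> b"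
    and "\<And>a b. a \<in> carrier A \<Longrightarrow> b \<in> carrier A \<Longrightarrow> \<phi> (a \<otimes>\<^bsub>A\<^esub> b) = \<phi> a \<otimes>\<^bsub>A\<^esub> \<phi> b"
    and "\<phi> \<one>\<^bsub>A\<^esub> = \<one>\<^bsub>A\<^esub>"
    and "\<And>c a. a \<in> carrier A \<Longrightarrow> \<phi> (c \<odot>\<^bsub>A\<^esub> a) = c \<odot>\<^bsub>A\<^esub> \<phi> a"
    and "\<phi> \<in> extensional (carrier A)"
    and "bij_betw \<phi> (carrier A) (carrier A)"
  using assms ring_iso_memE[of \<phi> A A] unfolding alg_auto_def by blast+

lemma carrier_alg_AutoGroup [simp]: "carrier (alg_AutoGroup A) = alg_auto A"
  by (simp add: alg_AutoGroup_def)

lemma alg_AutoGroup_mult: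
  assumes "\<phi> \<in> alg_auto A" "\<psi> \<in> alg_auto A"
  shows "\<phi> \<otimes>\<^bsub>alg_AutoGroup A\<^esub> \<psi> = compose (carrier A) \<phi> \<psi>"
  using alg_autoD(6,7)[OF assms(1)] alg_autoD(6,7)[OF assms(2)]
  by (simp add: alg_AutoGroup_def BijGroup_def Bij_def)

text \<open>
  Elements of the automorphism group are extensional, so they commute as soon as their
  compositions agree on the carrier.
\<close>

lemma alg_AutoGroup_commute_iff:
  assumes "\<phi> \<in> alg_auto A" "\<psi> \<in> alg_auto A"
  shows "\<phi> \<otimes>\<^bsub>alg_AutoGroup A\<^esub> \<psi> = \<psi> \<otimes>\<^bsub>alg_AutoGroup A\<^esub> \<phi> \<longleftrightarrow>
    (\<forall>a \<in> carrier A. \<phi> (\<psi> a) = \<psi> (\<phi> a))"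
  unfolding alg_AutoGroup_mult[OF assms] alg_AutoGroup_mult[OF assms(2,1)]
  by (auto simp: compose_def restrict_def fun_eq_iff)

definition lin_comb :: "('k::field, 'a) module \<Rightarrow> 'a list \<Rightarrow> 'k vec \<Rightarrow> 'a" where
  "lin_comb A bs v = (\<Oplus>\<^bsub>A\<^esub> i \<in> {..<length bs}. (v $ i) \<odot>\<^bsub>A\<^esub> (bs ! i))"

lemma alg_basis_lin_comb:
  "alg_basis A bs \<longleftrightarrow> set bs \<subseteq> carrier A \<and>
     (\<forall>a \<in> carrier A. \<exists>!v. v \<in> carrier_vec (length bs) \<and> a = lin_comb A bs v)"
  by (simp add: alg_basis_def lin_comb_def)

lemma basis_coords:
  assumes "alg_basis A bs" "a \<in> carrier A"
  shows "basis_coords A bs a \<in> carrier_vec (length bs)"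
    and "lin_comb A bs (basis_coords A bs a) = a"
proof -
  have "\<exists>!v. v \<in> carrier_vec (length bs) \<and> a = lin_comb A bs v"
    using assms by (simp add: alg_basis_lin_comb)
  from theI'[OF this] show "basis_coords A bs a \<in> carrier_vec (length bs)"
    and "lin_comb A bs (basis_coords A bs a) = a"
    by (simp_all add: basis_coords_def lin_comb_def)
qed

lemma basis_coords_eqI:
  assumes "alg_basis A bs" "v \<in> carrier_vec (length bs)" "lin_comb A bs v = a" "a \<in> carrier A"
  shows "basis_coords A bs a = v"
proof -
  have "\<exists>!w. w \<in> carrier_vec (length bs) \<and> a = lin_comb A bs w"
    using assms(1,4) by (simp add: alg_basis_lin_comb)
  from the1_equality[OF this, of v] show ?thesis
    using assms(2,3) by (simp add: basis_coords_def lin_comb_def)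
qed

lemma basis_coords_inject:
  assumes "alg_basis A bs" "a \<in> carrier A" "b \<in> carrier A"
    and "basis_coords A bs a = basis_coords A bs b"
  shows "a = b"
proof -
  have "a = lin_comb A bs (basis_coords A bs a)"
    by (rule basis_coords(2)[OF assms(1,2), symmetric])
  also have "\<dots> = b"
    unfolding assms(4) by (rule basis_coords(2)[OF assms(1,3)])
  finally show ?thesis .
qed

text \<open>
  The scalars of the algebras considered here range over a type, whereas \<^locale>\<open>module\<close> takes its
  scalars from a ring record; the record of the type connects the two.
\<close>

locale vector_space_record = module "ring_of_type_algebra :: 'k ring" A
  for A :: "('k::field, 'a) module"
begin

lemma smult_closed_type [simp]: "a \<in> carrier A \<Longrightarrow> c \<odot>\<^bsub>A\<^esub> a \<in> carrier A"
  by (rule smult_closed) simp_all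

lemma smult_add_left: "a \<in> carrier A \<Longrightarrow> (c + d) \<odot>\<^bsub>A\<^esub> a = c \<odot>\<^bsub>A\<^esub> a \<oplus>\<^bsub>A\<^esub> d \<odot>\<^bsub>A\<^esub> a"
  using smult_l_distr[of c d a] by simp

lemma smult_smult: "a \<in> carrier A \<Longrightarrow> (c * d) \<odot>\<^bsub>A\<^esub> a = c \<odot>\<^bsub>A\<^esub> (d \<odot>\<^bsub>A\<^esub> a)"
  using smult_assoc1[of c d a] by simp

lemma smult_zero_left: "a \<in> carrier A \<Longrightarrow> 0 \<odot>\<^bsub>A\<^esub> a = \<zero>\<^bsub>A\<^esub>"
  using smult_l_null[of a] by simp

lemma lin_comb_add:
  assumes "set bs \<subseteq> carrier A" "u \<in> carrier_vec (length bs)" "v \<in> carrier_vec (length bs)"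
  shows "lin_comb A bs (u + v) = lin_comb A bs u \<oplus>\<^bsub>A\<^esub> lin_comb A bs v"
proof -
  have "lin_comb A bs (u + v) =
      (\<Oplus>\<^bsub>A\<^esub> i \<in> {..<length bs}. (u $ i) \<odot>\<^bsub>A\<^esub> (bs ! i) \<oplus>\<^bsub>A\<^esub> (v $ i) \<odot>\<^bsub>A\<^esub> (bs ! i))"
    unfolding lin_comb_def using assms
    by (intro M.finsum_cong') (auto simp: smult_add_left dest!: nth_mem)
  also have "\<dots> = lin_comb A bs u \<oplus>\<^bsub>A\<^esub> lin_comb A bs v"
    unfolding lin_comb_def using assms by (intro M.finsum_addf) (auto dest!: nth_mem)
  finally show ?thesis .
qed

lemma lin_comb_smult:
  assumes "set bs \<subseteq> carrier A" "v \<in> carrier_vec (length bs)"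
  shows "lin_comb A bs (c \<cdot>\<^sub>v v) = c \<odot>\<^bsub>A\<^esub> lin_comb A bs v"
proof -
  have "lin_comb A bs (c \<cdot>\<^sub>v v) = (\<Oplus>\<^bsub>A\<^esub> i \<in> {..<length bs}. c \<odot>\<^bsub>A\<^esub> ((v $ i) \<odot>\<^bsub>A\<^esub> (bs ! i)))"
    unfolding lin_comb_def using assms
    by (intro M.finsum_cong') (auto simp: smult_smult dest!: nth_mem)
  also have "\<dots> = c \<odot>\<^bsub>A\<^esub> lin_comb A bs v"
    unfolding lin_comb_def using assms by (intro finsum_smult_ldistr[symmetric]) (auto dest!: nth_mem)
  finally show ?thesis .
qed

context
  fixes bs
  assumes basis: "alg_basis A bs"
begin

lemma basis_in_carrier: "set bs \<subseteq> carrier A"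
  using basis by (simp add: alg_basis_def)

lemma basis_coords_add:
  assumes "a \<in> carrier A" "b \<in> carrier A"
  shows "basis_coords A bs (a \<oplus>\<^bsub>A\<^esub> b) = basis_coords A bs a + basis_coords A bs b"
  using assms basis_coords[OF basis assms(1)] basis_coords[OF basis assms(2)]
  by (intro basis_coords_eqI[OF basis]) (auto simp: lin_comb_add[OF basis_in_carrier])

lemma basis_coords_smult:
  assumes "a \<in> carrier A"
  shows "basis_coords A bs (c \<odot>\<^bsub>A\<^esub> a) = c \<cdot>\<^sub>v basis_coords A bs a"
  using assms basis_coords[OF basis assms(1)]
  by (intro basis_coords_eqI[OF basis]) (auto simp: lin_comb_smult[OF basis_in_carrier])

lemma auto_lin_comb:
  assumes "\<phi> \<in> alg_auto A" "v \<in> carrier_vec (length bs)"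
  shows "\<phi> (lin_comb A bs v) = (\<Oplus>\<^bsub>A\<^esub> j \<in> {..<length bs}. (v $ j) \<odot>\<^bsub>A\<^esub> \<phi> (bs ! j))"
proof -
  have zero: "\<phi> \<zero>\<^bsub>A\<^esub> = \<zero>\<^bsub>A\<^esub>"
    using alg_autoD(5)[OF assms(1), of "\<zero>\<^bsub>A\<^esub>" 0] alg_autoD(1)[OF assms(1)]
    by (simp add: smult_zero_left)
  have "\<phi> (finsum A (\<lambda>i. (v $ i) \<odot>\<^bsub>A\<^esub> (bs ! i)) J) = finsum A (\<lambda>j. (v $ j) \<odot>\<^bsub>A\<^esub> \<phi> (bs ! j)) J"
    if "finite J" "J \<subseteq> {..<length bs}" for J
    using that
  proof (induction J rule: finite_induct)
    case empty
    then show ?case by (simp add: zero)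
  next
    case (insert j J)
    have b: "bs ! i \<in> carrier A" if "i \<in> insert j J" for i
      using insert.prems that basis_in_carrier by (auto simp: subset_iff)
    have f1: "(\<lambda>i. (v $ i) \<odot>\<^bsub>A\<^esub> (bs ! i)) \<in> J \<rightarrow> carrier A"
      using b by auto
    have f2: "(\<lambda>i. (v $ i) \<odot>\<^bsub>A\<^esub> \<phi> (bs ! i)) \<in> J \<rightarrow> carrier A"
      using b alg_autoD(1)[OF assms(1)] by auto
    show ?case
      using insert b f1 f2 alg_autoD(1)[OF assms(1)]
      by (simp add: M.finsum_insert alg_autoD(2,5)[OF assms(1)] M.finsum_closed)
  qed
  then show ?thesis
    by (simp add: lin_comb_def)
qed

text \<open>
  In coordinates an automorphism is multiplication by its matrix. This turns commutation of matrices
  into commutation of automorphisms.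
\<close>

lemma basis_coords_auto:
  assumes "\<phi> \<in> alg_auto A" "a \<in> carrier A"
  shows "basis_coords A bs (\<phi> a) = matrix_in_basis A bs \<phi> *\<^sub>v basis_coords A bs a"
proof -
  let ?d = "length bs" and ?v = "basis_coords A bs a" and ?c = "basis_coords A bs"
  have v: "?v \<in> carrier_vec ?d" and a: "lin_comb A bs ?v = a"
    using basis_coords[OF basis assms(2)] by auto
  have \<phi>b: "\<phi> (bs ! j) \<in> carrier A" if "j < ?d" for j
    using that basis_in_carrier alg_autoD(1)[OF assms(1)] by (auto simp: subset_iff)
  have dim: "dim_vec (?c x) = ?d" if "x \<in> carrier A" for x
    using basis_coords(1)[OF basis that] by auto
  have sum: "?c (finsum A (\<lambda>j. (?v $ j) \<odot>\<^bsub>A\<^esub> \<phi> (bs ! j)) J) $ i =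
      (\<Sum>j \<in> J. ?v $ j * ?c (\<phi> (bs ! j)) $ i)"
    if "finite J" "J \<subseteq> {..<?d}" "i < ?d" for J i
    using that
  proof (induction J rule: finite_induct)
    case empty
    have "?c \<zero>\<^bsub>A\<^esub> = 0 \<cdot>\<^sub>v ?c \<zero>\<^bsub>A\<^esub>"
      using basis_coords_smult[of "\<zero>\<^bsub>A\<^esub>" 0] by (simp add: smult_zero_left)
    then have "?c \<zero>\<^bsub>A\<^esub> $ i = (0 \<cdot>\<^sub>v ?c \<zero>\<^bsub>A\<^esub>) $ i"
      by (rule arg_cong)
    with empty show ?case by (simp add: dim)
  next
    case (insert j J)
    have f: "(\<lambda>i. (?v $ i) \<odot>\<^bsub>A\<^esub> \<phi> (bs ! i)) \<in> J \<rightarrow> carrier A"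
      using insert.prems \<phi>b by auto
    show ?case
      using insert f \<phi>b
      by (simp add: M.finsum_insert M.finsum_closed basis_coords_add basis_coords_smult dim)
  qed
  have "?c (\<phi> a) = ?c (finsum A (\<lambda>j. (?v $ j) \<odot>\<^bsub>A\<^esub> \<phi> (bs ! j)) {..<?d})"
    using auto_lin_comb[OF assms(1) v] a by simp
  moreover have "?c (\<phi> a) \<in> carrier_vec ?d"
    using basis_coords(1)[OF basis] alg_autoD(1)[OF assms] by auto
  ultimately show ?thesis
    using v by (intro eq_vecI)
      (auto simp: sum matrix_in_basis_def scalar_prod_def mult.commute lessThan_atLeast0)
qed

end

end


section \<open>Self-centralizing tori are maximal\<close>

lemma mult_carrier_GL [simp]: "g \<otimes>\<^bsub>GL d\<lparr>carrier := H\<rparr>\<^esub> h = g * h" "g \<otimes>\<^bsub>GL d\<^esub> h = g * h"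
  and one_GL: "\<one>\<^bsub>GL d\<^esub> = 1\<^sub>m d"
  by (simp_all add: GL_def units_of_def ring_mat_simps)

lemma GL_iff_det:
  "g \<in> carrier (GL d) \<longleftrightarrow> g \<in> carrier_mat d d \<and> det (g :: 'k::field mat) \<noteq> 0"
proof
  assume "g \<in> carrier (GL d)"
  then have "g \<in> Units (ring_mat TYPE('k) d ())"
    by (simp add: GL_def units_of_def)
  then show "g \<in> carrier_mat d d \<and> det g \<noteq> 0"
    using unit_imp_det_non_zero[of g d "()"] by (auto simp: Units_def ring_mat_simps)
next
  assume "g \<in> carrier_mat d d \<and> det g \<noteq> 0"
  then show "g \<in> carrier (GL d)"
    using det_non_zero_imp_unit[of g d "()"] by (simp add: GL_def units_of_def)
qed

text \<open>
  Extension of scalars maps the \<open>k\<close>-points of a closed set to its points over the closure.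
\<close>

lemma eval_entries_to_ac:
  assumes "p \<in> entry_polys d" "g \<in> carrier_mat d d"
  shows "eval_entries to_ac p (map_mat to_ac g) = to_ac (eval_entries id p g)"
proof -
  have "map_mat to_ac g $$ v = to_ac (g $$ v)"
    if "m \<in> Poly_Mapping.keys p" "v \<in> Poly_Mapping.keys m" for m v
      proof -
    obtain i j where "v = (i, j)" by (cases v)
    then show ?thesis
      using that assms unfolding entry_polys_def by fastforce
  qed
  then show ?thesis
    by (auto simp: eval_entries_def to_ac_sum to_ac_prod intro!: sum.cong prod.cong)
qed

interpretation to_ac: field_hom "to_ac :: 'k::field \<Rightarrow> 'k alg_closure"
  by unfold_locales simp_all

lemma diagonal_mat_mult_index:
  fixes x y :: "'k::field mat"
  assumes "x \<in> carrier_mat d d" "y \<in> carrier_mat d d" "diagonal_mat x" "diagonal_mat y"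
    and "i < d" "j < d"
  shows "(x * y) $$ (i, j) = (if i = j then x $$ (i, i) * y $$ (i, i) else 0)"
proof -
  have "(x * y) $$ (i, j) = (\<Sum>l \<in> {0..<d}. x $$ (i, l) * y $$ (l, j))"
    using assms by (simp add: scalar_prod_def)
  also have "\<dots> = (\<Sum>l \<in> {0..<d}. if l = i then x $$ (i, i) * y $$ (i, j) else 0)"
    using assms by (intro sum.cong) (auto simp: diagonal_mat_def)
  also have "\<dots> = (if i = j then x $$ (i, i) * y $$ (i, i) else 0)"
    using assms by (auto simp: diagonal_mat_def)
  finally show ?thesis .
qed

lemma diagonal_mats_commute:
  fixes g h :: "'k::field mat"
  assumes "g \<in> carrier_mat d d" "h \<in> carrier_mat d d" "diagonal_mat g" "diagonal_mat h"
  shows "g * h = h * g"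
  using assms
  by (intro eq_matI)
    (simp_all add: diagonal_mat_mult_index[of _ d] mult.commute del: index_mult_mat(1))

text \<open>
  The isomorphism with a group of diagonal matrices is given only over the algebraic closure, so
  commutativity is proved there and pulled back along the injective map \<^const>\<open>to_ac\<close>.
\<close>

lemma torus_points_commute:
  fixes g h :: "'k::field mat"
  assumes "torus_points d H" "g \<in> H" "h \<in> H"
  shows "g * h = h * g"
proof -
  obtain P r where P: "P \<subseteq> entry_polys d" "H = zero_locus id d P"
    and iso: "alg_group_isomorphic d (zero_locus (to_ac :: 'k \<Rightarrow> 'k alg_closure) d P) r (Gm_power r)"
    using assms(1) unfolding torus_points_def by blast
  let ?H = "zero_locus (to_ac :: 'k \<Rightarrow> 'k alg_closure) d P"
  obtain F F' where F: "F \<in> hom (GL d\<lparr>carrier := ?H\<rparr>) (GL r\<lparr>carrier := (Gm_power r :: 'k alg_closure mat set)\<rparr>)"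
    and F': "F' \<in> hom (GL r\<lparr>carrier := Gm_power r\<rparr>) (GL d\<lparr>carrier := ?H\<rparr>)"
    and F'F: "\<And>x. x \<in> ?H \<Longrightarrow> F' (F x) = x"
    using iso unfolding alg_group_isomorphic_def alg_group_hom_def by blast
  have carr: "x \<in> carrier_mat d d" if "x \<in> H" for x
    using that P(2) by (simp add: zero_locus_def GL_iff_det)
  have ext: "map_mat to_ac x \<in> ?H" if "x \<in> H" for x
    using that P carr[OF that]
    by (auto simp: zero_locus_def GL_iff_det eval_entries_to_ac subset_iff)
  have geometric: "x * y = y * x" if "x \<in> ?H" "y \<in> ?H" for x y
  proof -
    have Fx: "F x \<in> Gm_power r" "F y \<in> Gm_power r"
      using F that by (auto simp: hom_def)
    have "x * y = F' (F x) * F' (F y)"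
      using F'F that by simp
    also have "\<dots> = F' (F x * F y)"
      using F' Fx by (simp add: hom_def)
    also have "F x * F y = F y * F x"
      using Fx by (intro diagonal_mats_commute[of _ r]) (auto simp: Gm_power_def GL_iff_det)
    also have "F' (F y * F x) = F' (F y) * F' (F x)"
      using F' Fx by (simp add: hom_def)
    also have "\<dots> = y * x"
      using F'F that by simp
    finally show ?thesis .
  qed
  have "map_mat to_ac (g * h) = map_mat to_ac (h * g)"
    using geometric[OF ext[OF assms(2)] ext[OF assms(3)]] carr[OF assms(2)] carr[OF assms(3)]
    by (simp add: to_ac.mat_hom_mult)
  then show ?thesis
    by (simp add: to_ac.mat_hom_inj)
qed

text \<open>
  An automorphism is determined by its matrix in the basis that comes with the torus, so commuting
  matrices belong to commuting automorphisms.
\<close>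

lemma (in vector_space_record) torus_in_commute:
  assumes "torus_in A (alg_auto A) H" "\<phi> \<in> H" "\<psi> \<in> H"
  shows "\<phi> \<otimes>\<^bsub>alg_AutoGroup A\<^esub> \<psi> = \<psi> \<otimes>\<^bsub>alg_AutoGroup A\<^esub> \<phi>"
proof -
  obtain bs where basis: "alg_basis A bs" and H: "H \<subseteq> alg_auto A"
    and torus: "torus_points (length bs) (matrix_in_basis A bs ` H)"
    using assms(1) unfolding torus_in_def by blast
  have auto: "\<phi> \<in> alg_auto A" "\<psi> \<in> alg_auto A"
    using H assms by auto
  let ?M = "matrix_in_basis A bs"
  have M: "?M \<phi> * ?M \<psi> = ?M \<psi> * ?M \<phi>"
    by (rule torus_points_commute[OF torus imageI[OF assms(2)] imageI[OF assms(3)]])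
  have dim: "?M \<chi> \<in> carrier_mat (length bs) (length bs)" for \<chi>
    by (simp add: matrix_in_basis_def)
  have "\<phi> (\<psi> a) = \<psi> (\<phi> a)" if a: "a \<in> carrier A" for a
  proof (rule basis_coords_inject[OF basis])
    note carr = alg_autoD(1)[OF auto(1)] alg_autoD(1)[OF auto(2)]
    show "\<phi> (\<psi> a) \<in> carrier A" "\<psi> (\<phi> a) \<in> carrier A"
      using a carr by auto
    show "basis_coords A bs (\<phi> (\<psi> a)) = basis_coords A bs (\<psi> (\<phi> a))"
      unfolding basis_coords_auto[OF basis auto(1) carr(2)[OF a]]
        basis_coords_auto[OF basis auto(2) carr(1)[OF a]]
        basis_coords_auto[OF basis auto(1) a] basis_coords_auto[OF basis auto(2) a]
        assoc_mult_mat_vec[OF dim dim basis_coords(1)[OF basis a], symmetric] M ..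
  qed
  then show ?thesis
    by (simp add: alg_AutoGroup_commute_iff auto)
qed

text \<open>
  Every larger torus is commutative, and so lies in the centralizer.
\<close>

lemma (in vector_space_record) self_centralizing_torus_maximal:
  assumes "torus_in A (alg_auto A) T" "centralizer (alg_AutoGroup A) T = T"
  shows "maximal_torus_in A (alg_auto A) T"
  unfolding maximal_torus_in_def
proof (intro conjI allI impI)
  fix H assume H: "torus_in A (alg_auto A) H \<and> T \<subseteq> H"
  then have "H \<subseteq> alg_auto A"
    by (simp add: torus_in_def)
  with H torus_in_commute[OF conjunct1[OF H]] have "H \<subseteq> centralizer (alg_AutoGroup A) T"
    by (auto simp: centralizer_def)
  then show "H = T"
    using H assms(2) by blast
qed (rule assms(1))


section \<open>Diagonal tori given by characters\<close>

text \<open>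
  The value of the monomial with exponent \<open>m\<close> at the point \<open>c\<close>, i.e. the character of the torus given
  by \<open>m\<close>.
\<close>

definition mon_eval :: "('n \<Rightarrow> 'l) \<Rightarrow> ('n::finite \<Rightarrow>\<^sub>0 nat) \<Rightarrow> 'l::field" where
  "mon_eval c m = (\<Prod>x\<in>UNIV. c x ^ Poly_Mapping.lookup m x)"

lemma mon_eval_zero [simp]: "mon_eval c 0 = 1"
  by (simp add: mon_eval_def)

lemma mon_eval_add: "mon_eval c (m + m') = mon_eval c m * mon_eval c m'"
  by (simp add: mon_eval_def lookup_add power_add prod.distrib)

lemma mon_eval_single [simp]: "mon_eval c (Poly_Mapping.single x e) = c x ^ e"
proof -
  have "mon_eval c (Poly_Mapping.single x e) = (\<Prod>y\<in>UNIV. if y = x then c x ^ e else 1)"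
    unfolding mon_eval_def by (intro prod.cong) (auto simp: lookup_single)
  then show ?thesis by simp
qed

lemma mon_eval_mult: "mon_eval (\<lambda>x. c x * c' x) m = mon_eval c m * mon_eval c' m"
  by (simp add: mon_eval_def power_mult_distrib prod.distrib)

lemma mon_eval_one [simp]: "mon_eval (\<lambda>x. 1) m = 1"
  by (simp add: mon_eval_def)

lemma mon_eval_nonzero: "(\<And>x. c x \<noteq> 0) \<Longrightarrow> mon_eval c m \<noteq> 0"
  by (simp add: mon_eval_def)

definition torus_mat :: "('n::finite \<Rightarrow>\<^sub>0 nat) list \<Rightarrow> ('n \<Rightarrow> 'l::field) \<Rightarrow> 'l mat" where
  "torus_mat ms c =
     mat (length ms) (length ms) (\<lambda>(i, j). if i = j then mon_eval c (ms ! i) else 0)"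

definition torus_mats :: "('n::finite \<Rightarrow>\<^sub>0 nat) list \<Rightarrow> 'l::field mat set" where
  "torus_mats ms = torus_mat ms ` {c. \<forall>x. c x \<noteq> 0}"

lemma torus_mat_carrier [simp]: "torus_mat ms c \<in> carrier_mat (length ms) (length ms)"
  by (simp add: torus_mat_def)

lemma torus_mat_diagonal: "diagonal_mat (torus_mat ms c)"
  by (simp add: torus_mat_def diagonal_mat_def)

lemma torus_mat_mult: "torus_mat ms c * torus_mat ms c' = torus_mat ms (\<lambda>x. c x * c' x)"
proof (rule eq_matI)
  fix i j assume "i < dim_row (torus_mat ms (\<lambda>x. c x * c' x))"
    "j < dim_col (torus_mat ms (\<lambda>x. c x * c' x))"
  then have "i < length ms" "j < length ms"
    by (simp_all add: torus_mat_def)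
  then show "(torus_mat ms c * torus_mat ms c') $$ (i, j) = torus_mat ms (\<lambda>x. c x * c' x) $$ (i, j)"
    by (subst diagonal_mat_mult_index[OF torus_mat_carrier torus_mat_carrier
          torus_mat_diagonal torus_mat_diagonal])
      (simp_all add: torus_mat_def mon_eval_mult)
qed (simp_all add: torus_mat_def)

lemma torus_mat_one: "torus_mat ms (\<lambda>x. 1) = 1\<^sub>m (length ms)"
  by (intro eq_matI) (auto simp: torus_mat_def)

lemma det_diagonal_mat:
  assumes "g \<in> carrier_mat d d" "diagonal_mat (g :: 'k::field mat)"
  shows "det g = (\<Prod>i<d. g $$ (i, i))"
proof -
  have "upper_triangular g"
    using assms by (auto simp: upper_triangular_def diagonal_mat_def)
  then have "det g = prod_list (diag_mat g)"
    using assms(1) by (rule det_upper_triangular)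
  then show ?thesis
    using assms(1) by (simp add: prod_list_diag_prod lessThan_atLeast0)
qed

lemma torus_mat_GL:
  assumes "\<And>x. c x \<noteq> 0"
  shows "torus_mat ms c \<in> carrier (GL (length ms))"
  using assms
  by (simp add: GL_iff_det det_diagonal_mat[OF torus_mat_carrier torus_mat_diagonal])
    (simp add: torus_mat_def mon_eval_nonzero)

text \<open>
  The characters are multiplicative, so products and inverses of the matrices come from products and
  inverses of the points \<open>c\<close>.
\<close>

lemma torus_mats_subgroup: "subgroup (torus_mats ms :: 'l::field mat set) (GL (length ms))"
proof -
  interpret ring "ring_mat TYPE('l) (length ms) ()"
    by (rule ring_mat)
  have group: "group (GL (length ms) :: 'l mat monoid)"
    unfolding GL_def by (rule units_group)
  interpret group "GL (length ms) :: 'l mat monoid"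
    by (rule group)
  show ?thesis
  proof (rule subgroup.intro)
    show "(torus_mats ms :: 'l mat set) \<subseteq> carrier (GL (length ms))"
      by (auto simp: torus_mats_def torus_mat_GL)
    show "\<one>\<^bsub>GL (length ms)\<^esub> \<in> (torus_mats ms :: 'l mat set)"
      unfolding one_GL torus_mats_def
      by (rule image_eqI[of _ _ "\<lambda>x. 1"]) (simp_all add: torus_mat_one)
    fix g assume "g \<in> (torus_mats ms :: 'l mat set)"
    then obtain c where c: "g = torus_mat ms c" "\<And>x. c x \<noteq> 0"
      by (auto simp: torus_mats_def)
    let ?h = "torus_mat ms (\<lambda>x. inverse (c x))"
    have "inv\<^bsub>GL (length ms)\<^esub> g = ?h"
      using c by (intro inv_equality)
        (simp_all add: torus_mat_mult one_GL torus_mat_one torus_mat_GL)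
    then show "inv\<^bsub>GL (length ms)\<^esub> g \<in> torus_mats ms"
      using c by (auto simp: torus_mats_def)
  next
    fix g h assume "g \<in> (torus_mats ms :: 'l mat set)" "h \<in> (torus_mats ms :: 'l mat set)"
    then show "g \<otimes>\<^bsub>GL (length ms)\<^esub> h \<in> torus_mats ms"
      by (auto simp: torus_mats_def torus_mat_mult)
  qed
qed

lemma eval_entries_superset:
  assumes "\<sigma> 0 = 0" "finite V" "Poly_Mapping.keys p \<subseteq> V"
  shows "eval_entries \<sigma> p g = (\<Sum>m \<in> V. \<sigma> (Poly_Mapping.lookup p m) *
        (\<Prod>v \<in> Poly_Mapping.keys m. g $$ v ^ Poly_Mapping.lookup m v))"
  unfolding eval_entries_def using assms
  by (intro sum.mono_neutral_left) (auto simp: not_in_keys_iff_lookup_eq_zero)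

lemma eval_entries_diff:
  assumes "\<sigma> 0 = 0" "\<And>a b. \<sigma> (a - b) = \<sigma> a - \<sigma> b"
  shows "eval_entries \<sigma> (p - q) g = eval_entries \<sigma> p g - eval_entries \<sigma> q g"
proof -
  let ?V = "Poly_Mapping.keys p \<union> Poly_Mapping.keys q"
  have "Poly_Mapping.keys (p - q) \<subseteq> ?V"
    by (auto simp: in_keys_iff lookup_minus)
  then show ?thesis
    using assms
    by (simp add: eval_entries_superset[of \<sigma> ?V] lookup_minus left_diff_distrib sum_subtractf)
qed

lemma eval_entries_single:
  assumes "\<sigma> 0 = 0"
  shows "eval_entries \<sigma> (Poly_Mapping.single m a) g =
    \<sigma> a * (\<Prod>v \<in> Poly_Mapping.keys m. g $$ v ^ Poly_Mapping.lookup m v)"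
  using assms by (cases "a = 0") (simp_all add: eval_entries_def)

text \<open>
  The monomial with exponent \<open>m\<close> in which the variable \<open>x\<close> is replaced by the diagonal matrix entry at
  position \<open>p x\<close>.
\<close>

definition entry_monomial :: "('n::finite \<Rightarrow> nat) \<Rightarrow> ('n \<Rightarrow>\<^sub>0 nat) \<Rightarrow> (nat \<times> nat) \<Rightarrow>\<^sub>0 nat" where
  "entry_monomial p m = (\<Sum>x\<in>UNIV. Poly_Mapping.single (p x, p x) (Poly_Mapping.lookup m x))"

lemma lookup_entry_monomial:
  assumes "inj p"
  shows "Poly_Mapping.lookup (entry_monomial p m) (p x, p x) = Poly_Mapping.lookup m x"
proof -
  have "Poly_Mapping.lookup (entry_monomial p m) (p x, p x) =
      (\<Sum>y\<in>UNIV. if y = x then Poly_Mapping.lookup m x else 0)"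
    unfolding entry_monomial_def lookup_sum
    using assms by (intro sum.cong) (auto simp: lookup_single when_def inj_eq)
  then show ?thesis by simp
qed

lemma keys_entry_monomial: "Poly_Mapping.keys (entry_monomial p m) \<subseteq> (\<lambda>x. (p x, p x)) ` UNIV"
proof
  fix v assume "v \<in> Poly_Mapping.keys (entry_monomial p m)"
  then have "(\<Sum>y\<in>UNIV. Poly_Mapping.lookup (Poly_Mapping.single (p y, p y) (Poly_Mapping.lookup m y)) v) \<noteq> 0"
    by (simp add: in_keys_iff entry_monomial_def lookup_sum)
  then obtain y where "Poly_Mapping.lookup (Poly_Mapping.single (p y, p y) (Poly_Mapping.lookup m y)) v \<noteq> 0"
    by (meson sum.neutral)
  then show "v \<in> (\<lambda>x. (p x, p x)) ` UNIV"
    by (auto simp: lookup_single when_def split: if_splits)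
qed

lemma eval_entry_monomial:
  assumes "inj p" "\<sigma> 0 = 0" "\<sigma> 1 = 1"
  shows "eval_entries \<sigma> (Poly_Mapping.single (entry_monomial p m) 1) g =
    mon_eval (\<lambda>x. g $$ (p x, p x)) m"
proof -
  have inj: "inj (\<lambda>x. (p x, p x))"
    using assms(1) by (auto simp: inj_def)
  have "eval_entries \<sigma> (Poly_Mapping.single (entry_monomial p m) 1) g =
      (\<Prod>v \<in> (\<lambda>x. (p x, p x)) ` UNIV. g $$ v ^ Poly_Mapping.lookup (entry_monomial p m) v)"
    unfolding eval_entries_single[where \<sigma> = \<sigma>, OF assms(2)] assms(3) mult_1
    by (rule prod.mono_neutral_left)
      (use keys_entry_monomial in \<open>auto simp: not_in_keys_iff_lookup_eq_zero\<close>)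
  also have "\<dots> = mon_eval (\<lambda>x. g $$ (p x, p x)) m"
    unfolding mon_eval_def
    by (simp add: prod.reindex[OF inj] lookup_entry_monomial[OF assms(1)])
  finally show ?thesis .
qed

text \<open>
  If the variables occur among the exponents \<open>ms\<close>, then the diagonal entries at their positions are
  coordinates on the group \<^const>\<open>torus_mats\<close>.
\<close>

definition variable_positions :: "('n::finite \<Rightarrow>\<^sub>0 nat) list \<Rightarrow> ('n \<Rightarrow> nat) \<Rightarrow> bool" where
  "variable_positions ms p \<longleftrightarrow> (\<forall>x. p x < length ms \<and> ms ! p x = Poly_Mapping.single x 1)"

lemma variable_positions_exist:
  assumes "\<And>x. Poly_Mapping.single x 1 \<in> set ms"
  obtains p where "variable_positions ms p"
proof -
  have "\<forall>x. \<exists>i<length ms. ms ! i = Poly_Mapping.single x 1"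
    using assms by (auto simp: in_set_conv_nth)
  then have "\<exists>p. \<forall>x. p x < length ms \<and> ms ! p x = Poly_Mapping.single x 1"
    by (intro choice) auto
  then show ?thesis
    using that by (auto simp: variable_positions_def)
qed

lemma variable_positions_inj:
  assumes "variable_positions ms p"
  shows "inj p"
proof (rule injI)
  fix x y assume "p x = p y"
  then have "Poly_Mapping.single x (1::nat) = Poly_Mapping.single y 1"
    using assms unfolding variable_positions_def by metis
  then have "Poly_Mapping.keys (Poly_Mapping.single x (1::nat)) = Poly_Mapping.keys (Poly_Mapping.single y (1::nat))"
    by simp
  then show "x = y"
    by simp
qed

lemma torus_mat_position:
  assumes "variable_positions ms p"
  shows "torus_mat ms c $$ (p x, p x) = c x"
  using assms by (simp add: variable_positions_def torus_mat_def)

text \<open>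
  The matrix is diagonal, and each diagonal entry is the prescribed monomial in the entries that belong
  to the variables. No equation says that the entries are nonzero: this follows from invertibility.
\<close>

definition torus_eqs :: "('n::finite \<Rightarrow>\<^sub>0 nat) list \<Rightarrow> ('n \<Rightarrow> nat) \<Rightarrow> 'k::field entry_poly set" where
  "torus_eqs ms p =
     {Poly_Mapping.single (Poly_Mapping.single (i, j) 1) 1 | i j.
        i < length ms \<and> j < length ms \<and> i \<noteq> j} \<union>
     {Poly_Mapping.single (Poly_Mapping.single (i, i) 1) 1 -
        Poly_Mapping.single (entry_monomial p (ms ! i)) 1 | i. i < length ms}"

lemma torus_eqs_entry_polys:
  assumes "variable_positions ms p"
  shows "torus_eqs ms p \<subseteq> entry_polys (length ms)"
proof
  fix q assume "q \<in> (torus_eqs ms p :: 'k::field entry_poly set)"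
  then consider (off) i j where "q = Poly_Mapping.single (Poly_Mapping.single (i, j) 1) 1"
      "i < length ms" "j < length ms"
    | (diag) i where "q = Poly_Mapping.single (Poly_Mapping.single (i, i) 1) 1 -
        Poly_Mapping.single (entry_monomial p (ms ! i)) 1" "i < length ms"
    unfolding torus_eqs_def by blast
  then show "q \<in> entry_polys (length ms)"
  proof cases
    case off
    then show ?thesis by (simp add: entry_polys_def)
  next
    case diag
    have "Poly_Mapping.keys q \<subseteq> {Poly_Mapping.single (i, i) 1, entry_monomial p (ms ! i)}"
      by (auto simp: diag in_keys_iff lookup_minus lookup_single when_def split: if_splits)
    moreover have "Poly_Mapping.keys (entry_monomial p (ms ! i)) \<subseteq> {..<length ms} \<times> {..<length ms}"
      using keys_entry_monomial[of p "ms ! i"] assms by (auto simp: variable_positions_def)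
    ultimately show ?thesis
      using diag(2) unfolding entry_polys_def by auto
  qed
qed

text \<open>
  The map \<open>\<sigma>\<close> is left arbitrary so that the same equations describe the points over the field itself and
  over its algebraic closure.
\<close>

lemma zero_locus_torus_eqs:
  fixes \<sigma> :: "'k::field \<Rightarrow> 'l::field"
  assumes p: "variable_positions ms p"
    and \<sigma>: "\<sigma> 0 = 0" "\<sigma> 1 = 1" "\<And>a b. \<sigma> (a - b) = \<sigma> a - \<sigma> b"
  shows "zero_locus \<sigma> (length ms) (torus_eqs ms p) = torus_mats ms"
proof -
  let ?d = "length ms"
  note eval = eval_entry_monomial[where \<sigma> = \<sigma>, OF variable_positions_inj[OF p] \<sigma>(1,2)]
    eval_entries_diff[where \<sigma> = \<sigma>, OF \<sigma>(1,3)]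
  have entry: "eval_entries \<sigma> (Poly_Mapping.single (Poly_Mapping.single (i, j) 1) 1) g = g $$ (i, j)"
    for i j g
    by (simp add: eval_entries_single[where \<sigma> = \<sigma>, OF \<sigma>(1)] \<sigma>(2))
  have iff: "g \<in> zero_locus \<sigma> ?d (torus_eqs ms p) \<longleftrightarrow> g \<in> carrier (GL ?d) \<and>
      (\<forall>i<?d. \<forall>j<?d. i \<noteq> j \<longrightarrow> g $$ (i, j) = 0) \<and>
      (\<forall>i<?d. g $$ (i, i) = mon_eval (\<lambda>x. g $$ (p x, p x)) (ms ! i))" for g :: "'l mat"
  proof -
    have "(\<forall>q \<in> torus_eqs ms p. eval_entries \<sigma> q g = 0) \<longleftrightarrow>
      (\<forall>i j. i < ?d \<and> j < ?d \<and> i \<noteq> j \<longrightarrow>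
         eval_entries \<sigma> (Poly_Mapping.single (Poly_Mapping.single (i, j) 1) 1) g = 0) \<and>
      (\<forall>i<?d. eval_entries \<sigma> (Poly_Mapping.single (Poly_Mapping.single (i, i) 1) 1 -
        Poly_Mapping.single (entry_monomial p (ms ! i)) 1) g = 0)"
      unfolding torus_eqs_def by blast
    then show ?thesis
      unfolding zero_locus_def eval entry by auto
  qed
  show ?thesis
  proof (intro subset_antisym subsetI)
    fix g :: "'l mat" assume "g \<in> zero_locus \<sigma> ?d (torus_eqs ms p)"
    then have GL: "g \<in> carrier (GL ?d)"
      and off: "\<And>i j. i < ?d \<Longrightarrow> j < ?d \<Longrightarrow> i \<noteq> j \<Longrightarrow> g $$ (i, j) = 0"
      and diag: "\<And>i. i < ?d \<Longrightarrow> g $$ (i, i) = mon_eval (\<lambda>x. g $$ (p x, p x)) (ms ! i)"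
      by (auto simp: iff)
    have g: "g \<in> carrier_mat ?d ?d" "det g \<noteq> 0"
      using GL by (auto simp: GL_iff_det)
    have "diagonal_mat g"
      using g off by (auto simp: diagonal_mat_def)
    with g have "g $$ (p x, p x) \<noteq> 0" for x
      using p by (auto simp: det_diagonal_mat variable_positions_def)
    moreover have "g = torus_mat ms (\<lambda>x. g $$ (p x, p x))"
      using g off diag by (intro eq_matI) (auto simp: torus_mat_def)
    ultimately show "g \<in> torus_mats ms"
      unfolding torus_mats_def by blast
  next
    fix g :: "'l mat" assume "g \<in> torus_mats ms"
    then obtain c where c: "g = torus_mat ms c" "\<And>x. c x \<noteq> 0"
      by (auto simp: torus_mats_def)
    show "g \<in> zero_locus \<sigma> ?d (torus_eqs ms p)"
      unfolding iff c(1) torus_mat_position[OF p] using torus_mat_GL[OF c(2)]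
      by (auto simp: torus_mat_def)
  qed
qed

text \<open>
  The point \<open>c\<close> is read off from the entries at the variables, and the other matrix is made of
  monomials in \<open>c\<close>. So the map is given by monomials in the matrix entries and needs no determinant as
  denominator.
\<close>

lemma torus_mats_hom:
  fixes ms ms' :: "('n::finite \<Rightarrow>\<^sub>0 nat) list"
  assumes p: "variable_positions ms p"
  shows "alg_group_hom (length ms) (torus_mats ms) (length ms') (torus_mats ms')
    (\<lambda>g. torus_mat ms' (\<lambda>x. g $$ (p x, p x)))"
  unfolding alg_group_hom_def
proof (intro conjI allI impI)
  show "(\<lambda>g. torus_mat ms' (\<lambda>x. g $$ (p x, p x))) \<in>
      hom (GL (length ms)\<lparr>carrier := torus_mats ms\<rparr>) (GL (length ms')\<lparr>carrier := torus_mats ms'\<rparr>)"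
    by (auto simp: hom_def torus_mats_def torus_mat_mult torus_mat_position[OF p])
  fix i j assume ij: "i < length ms'" "j < length ms'"
  show "regular_on (length ms) (torus_mats ms)
      (\<lambda>g. torus_mat ms' (\<lambda>x. g $$ (p x, p x)) $$ (i, j))"
  proof (cases "i = j")
    case True
    have "Poly_Mapping.single (entry_monomial p (ms' ! i)) 1 \<in> entry_polys (length ms)"
      using keys_entry_monomial[of p "ms' ! i"] p
      by (auto simp: entry_polys_def variable_positions_def)
    moreover have "\<forall>g \<in> torus_mats ms. torus_mat ms' (\<lambda>x. g $$ (p x, p x)) $$ (i, j) =
        eval_entries id (Poly_Mapping.single (entry_monomial p (ms' ! i)) 1) g / det g ^ 0"
      using ij True
      by (simp add: torus_mat_def eval_entry_monomial[OF variable_positions_inj[OF p]])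
    ultimately show ?thesis
      unfolding regular_on_def by blast
  next
    case False
    then show ?thesis
      unfolding regular_on_def using ij
      by (intro bexI[of _ 0] exI[of _ 0]) (auto simp: torus_mat_def eval_entries_def entry_polys_def)
  qed
qed

text \<open>
  The two maps of the previous lemma, with the roles of the lists exchanged, recover the same point
  \<open>c\<close>, so they are inverse to each other.
\<close>

lemma torus_mats_isomorphic:
  fixes ms ms' :: "('n::finite \<Rightarrow>\<^sub>0 nat) list"
  assumes "variable_positions ms p" "variable_positions ms' p'"
  shows "alg_group_isomorphic (length ms) (torus_mats ms) (length ms') (torus_mats ms')"
  unfolding alg_group_isomorphic_def
  using torus_mats_hom[OF assms(1), of ms'] torus_mats_hom[OF assms(2), of ms]
  by (intro exI[of _ "\<lambda>g. torus_mat ms' (\<lambda>x. g $$ (p x, p x))"]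
      exI[of _ "\<lambda>g. torus_mat ms (\<lambda>x. g $$ (p' x, p' x))"])
    (auto simp: torus_mats_def torus_mat_position[OF assms(1)] torus_mat_position[OF assms(2)])

lemma Gm_power_eq_torus_mats:
  assumes "distinct xs" "set xs = (UNIV :: 'n::finite set)"
  shows "Gm_power (length xs) = torus_mats (map (\<lambda>x. Poly_Mapping.single x 1) xs)"
    (is "_ = torus_mats ?ms")
proof -
  obtain p where p: "\<And>x. p x < length xs" "\<And>x. xs ! p x = x"
  proof -
    have "\<forall>x. \<exists>i<length xs. xs ! i = x"
      using assms(2) by (simp flip: in_set_conv_nth)
    then have "\<exists>p. \<forall>x. p x < length xs \<and> xs ! p x = x"
      by (intro choice) auto
    then show ?thesis
      using that by blast
  qed
  have p_nth: "p (xs ! i) = i" if "i < length xs" for i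
    using nth_eq_iff_index_eq[OF assms(1), of "p (xs ! i)" i] that p by simp
  show ?thesis
  proof (intro subset_antisym subsetI)
    fix g :: "'a mat" assume "g \<in> Gm_power (length xs)"
    then have g: "g \<in> carrier_mat (length xs) (length xs)" "det g \<noteq> 0" "diagonal_mat g"
      by (auto simp: Gm_power_def GL_iff_det)
    then have "g $$ (p x, p x) \<noteq> 0" for x
      using p by (auto simp: det_diagonal_mat)
    moreover have "g = torus_mat ?ms (\<lambda>x. g $$ (p x, p x))"
      using g by (intro eq_matI) (auto simp: torus_mat_def p_nth diagonal_mat_def)
    ultimately show "g \<in> torus_mats ?ms"
      unfolding torus_mats_def by blast
  next
    fix g :: "'a mat" assume "g \<in> torus_mats ?ms"
    then show "g \<in> Gm_power (length xs)"
      using torus_mat_GL[of _ ?ms] by (auto simp: torus_mats_def Gm_power_def torus_mat_diagonal)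
  qed
qed

lemma torus_points_torus_mats:
  fixes ms :: "('n::finite \<Rightarrow>\<^sub>0 nat) list"
  assumes "\<And>x. Poly_Mapping.single x 1 \<in> set ms"
  shows "torus_points (length ms) (torus_mats ms :: 'k::field mat set)"
proof -
  obtain p where p: "variable_positions ms p"
    using variable_positions_exist[OF assms] .
  obtain xs where xs: "distinct xs" "set xs = (UNIV :: 'n set)"
    using finite_distinct_list[of "UNIV :: 'n set"] by auto
  let ?ms = "map (\<lambda>x. Poly_Mapping.single x (1::nat)) xs"
  obtain p' where p': "variable_positions ?ms p'"
    using variable_positions_exist[of ?ms] xs by auto
  have locus: "zero_locus (to_ac :: 'k \<Rightarrow> 'k alg_closure) (length ms) (torus_eqs ms p) = torus_mats ms"
    by (rule zero_locus_torus_eqs[OF p]) simp_all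
  have "zero_locus id (length ms) (torus_eqs ms p) = (torus_mats ms :: 'k mat set)"
    by (rule zero_locus_torus_eqs[OF p]) simp_all
  moreover have "alg_group_isomorphic (length ms) (torus_mats ms) (length xs)
      (Gm_power (length xs) :: 'k alg_closure mat set)"
    using torus_mats_isomorphic[OF p p'] by (simp add: Gm_power_eq_torus_mats[OF xs])
  ultimately show ?thesis
    unfolding torus_points_def
    using torus_eqs_entry_polys[OF p] torus_mats_subgroup
    by (intro exI[of _ "torus_eqs ms p"]) (auto simp: locus)
qed


section \<open>Monomial ideals and their quotient algebras\<close>

lemma poly_mapping_sum_singles:
  "(\<Sum>m \<in> Poly_Mapping.keys f. Poly_Mapping.single m (Poly_Mapping.lookup f m)) = f"
  by (rule poly_mapping_eqI)
    (simp add: lookup_sum lookup_single when_def sum.delta in_keys_iff)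

lemma octant_poly_induct [case_names zero single add]:
  assumes "P 0" "\<And>m a. P (Poly_Mapping.single m a)" "\<And>f g. P f \<Longrightarrow> P g \<Longrightarrow> P (f + g)"
  shows "P (f :: 'a \<Rightarrow>\<^sub>0 'k::comm_monoid_add)"
proof -
  have "P (\<Sum>m \<in> K. Poly_Mapping.single m (Poly_Mapping.lookup f m))" if "finite K" for K
    using that by (induction K rule: finite_induct) (auto intro: assms)
  from this[OF finite_keys[of f]] show ?thesis
    by (simp add: poly_mapping_sum_singles)
qed

lemma octant_ring_is_ring: "ring (octant_ring :: ('n, 'k::field) octant_poly ring)"
  by (rule ring_from_type_algebra)

lemma monomial_ideal_is_ideal:
  fixes I :: "('n, 'k::field) octant_poly set"
  assumes "monomial_ideal I"
  shows "ideal I octant_ring"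
proof -
  interpret ring "octant_ring :: ('n, 'k) octant_poly ring"
    by (rule octant_ring_is_ring)
  show ?thesis
    using assms genideal_ideal unfolding monomial_ideal_def by auto
qed

lemma ideal_closed:
  fixes I :: "('n, 'k::field) octant_poly set"
  assumes "ideal I octant_ring"
  shows "0 \<in> I" "f \<in> I \<Longrightarrow> g \<in> I \<Longrightarrow> f + g \<in> I" "f \<in> I \<Longrightarrow> h * f \<in> I"
proof -
  interpret ideal I "octant_ring :: ('n, 'k) octant_poly ring"
    by (rule assms)
  show "0 \<in> I" using additive_subgroup.zero_closed[OF ideal.axioms(1)[OF assms]] by simp
  show "f \<in> I \<Longrightarrow> g \<in> I \<Longrightarrow> f + g \<in> I" using additive_subgroup.a_closed[OF ideal.axioms(1)[OF assms], of f g] by simp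
  show "f \<in> I \<Longrightarrow> h * f \<in> I" using I_l_closed[of f h] by simp
qed

lemma ideal_supp_add:
  assumes "ideal I octant_ring" "m \<in> ideal_supp (I :: ('n, 'k::field) octant_poly set)"
  shows "m' + m \<in> ideal_supp I"
  using ideal_closed(3)[OF assms(1), of "monomial m" "monomial m'"] assms(2)
  by (simp add: ideal_supp_def mult_single)

text \<open>
  The polynomials with all exponents in the support form an ideal, because the support is closed under
  adding exponents; this ideal contains the generating monomials, hence \<open>I\<close>. Conversely, \<open>I\<close> contains all
  multiples of its monomials and their sums.
\<close>

lemma monomial_ideal_iff_keys:
  fixes I :: "('n, 'k::field) octant_poly set"
  assumes "monomial_ideal I"
  shows "f \<in> I \<longleftrightarrow> Poly_Mapping.keys f \<subseteq> ideal_supp I"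
proof -
  interpret ring "octant_ring :: ('n, 'k) octant_poly ring"
    by (rule octant_ring_is_ring)
  have I: "ideal I octant_ring"
    by (rule monomial_ideal_is_ideal[OF assms])
  define J where "J = {f :: ('n, 'k) octant_poly. Poly_Mapping.keys f \<subseteq> ideal_supp I}"
  have neg: "- f \<in> J" if "f \<in> J" for f
    using that by (simp add: J_def)
  have add: "f + g \<in> J" if "f \<in> J" "g \<in> J" for f g
    using that keys_add[of f g] by (auto simp: J_def)
  have mult: "h * f \<in> J" if "f \<in> J" for f h
  proof -
    have "Poly_Mapping.keys (h * f) \<subseteq> ideal_supp I"
      using that keys_mult[of h f] ideal_supp_add[OF I] by (fastforce simp: J_def)
    then show ?thesis by (simp add: J_def)
  qed
  have "ideal J octant_ring"
  proof (rule idealI)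
    show "subgroup J (add_monoid octant_ring)"
    proof (rule group.subgroupI)
      show "group (add_monoid (octant_ring :: ('n, 'k) octant_poly ring))"
        using a_group .
      have "0 \<in> J" by (simp add: J_def)
      then show "J \<noteq> {}" by blast
      fix f assume f: "f \<in> J"
      have "inv\<^bsub>add_monoid octant_ring\<^esub> f = - f"
        using a_minus_type_algebra[of 0 f] by (simp add: a_minus_def a_inv_def)
      then show "inv\<^bsub>add_monoid octant_ring\<^esub> f \<in> J"
        using neg[OF f] by simp
    qed (auto simp: add)
  qed (use octant_ring_is_ring mult in \<open>auto simp: mult.commute\<close>)
  moreover obtain F where F: "I = Idl\<^bsub>octant_ring\<^esub> (monomial ` F)"
    using assms by (auto simp: monomial_ideal_def)
  moreover have "monomial ` F \<subseteq> J"
    using genideal_self[of "monomial ` F"] F by (auto simp: J_def ideal_supp_def)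
  ultimately have "I \<subseteq> J"
    using genideal_minimal by auto
  moreover have "f \<in> I" if "f \<in> J" for f
  proof -
    have single: "Poly_Mapping.single m a \<in> I" if "m \<in> ideal_supp I" for m a
      using ideal_closed(3)[OF I, of "monomial m" "Poly_Mapping.single 0 a"] that
      by (simp add: ideal_supp_def mult_single)
    have "(\<Sum>m \<in> K. Poly_Mapping.single m (Poly_Mapping.lookup f m)) \<in> I"
      if "finite K" "K \<subseteq> ideal_supp I" for K
      using that by (induction K rule: finite_induct) (auto intro: ideal_closed[OF I] single)
    from this[of "Poly_Mapping.keys f"] show ?thesis
      using that by (simp add: J_def poly_mapping_sum_singles)
  qed
  ultimately show ?thesis
    by (auto simp: J_def)
qed

abbreviation cls :: "('n, 'k::field) octant_poly set \<Rightarrow> ('n, 'k) octant_poly \<Rightarrow> ('n, 'k) octant_poly set"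
  where "cls I f \<equiv> I +>\<^bsub>octant_ring\<^esub> f"

lemma cls_image: "cls I f = (\<lambda>h. h + f) ` I"
  by (auto simp: a_r_coset_def r_coset_def)

lemma cls_eq_iff:
  fixes I :: "('n, 'k::field) octant_poly set"
  assumes "ideal I octant_ring"
  shows "cls I f = cls I g \<longleftrightarrow> f - g \<in> I"
  using ring.quotient_eq_iff_same_a_r_cos[OF octant_ring_is_ring assms, of f g] by simp

lemma carrier_quot_alg: "carrier (quot_alg I) = range (cls I)"
  by (auto simp: quot_alg_def ring.defs module.defs FactRing_def A_RCOSETS_def RCOSETS_def
      a_r_coset_def)

lemma quot_alg_simps:
  fixes I :: "('n, 'k::field) octant_poly set"
  assumes "ideal I octant_ring"
  shows "cls I f \<oplus>\<^bsub>quot_alg I\<^esub> cls I g = cls I (f + g)"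
    and "cls I f \<otimes>\<^bsub>quot_alg I\<^esub> cls I g = cls I (f * g)"
    and "c \<odot>\<^bsub>quot_alg I\<^esub> cls I f = cls I (Poly_Mapping.single 0 c * f)"
    and "\<zero>\<^bsub>quot_alg I\<^esub> = cls I 0"
    and "\<one>\<^bsub>quot_alg I\<^esub> = cls I 1"
proof -
  interpret ideal I "octant_ring :: ('n, 'k) octant_poly ring"
    by (rule assms)
  show "cls I f \<oplus>\<^bsub>quot_alg I\<^esub> cls I g = cls I (f + g)"
    and "cls I f \<otimes>\<^bsub>quot_alg I\<^esub> cls I g = cls I (f * g)"
    and "c \<odot>\<^bsub>quot_alg I\<^esub> cls I f = cls I (Poly_Mapping.single 0 c * f)"
    and "\<zero>\<^bsub>quot_alg I\<^esub> = cls I 0"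
    and "\<one>\<^bsub>quot_alg I\<^esub> = cls I 1"
    using rcoset_mult_add[of f g] rcoset_mult_add[of "Poly_Mapping.single 0 c" f] a_rcos_sum[of f g]
    by (simp_all add: quot_alg_def ring.defs module.defs FactRing_def cls_image)
qed

lemma quot_alg_vector_space:
  fixes I :: "('n, 'k::field) octant_poly set"
  assumes "ideal I octant_ring"
  shows "vector_space_record (quot_alg I)"
proof -
  note simps = quot_alg_simps[OF assms]
  have "module ring_of_type_algebra (quot_alg I)"
  proof (rule moduleI)
    show "cring (ring_of_type_algebra :: 'k ring)" by rule
    show "abelian_group (quot_alg I)"
    proof (rule abelian_groupI)
      fix a assume "a \<in> carrier (quot_alg I)"
      then obtain f where "a = cls I f"
        by (auto simp: carrier_quot_alg)
      then show "\<exists>b \<in> carrier (quot_alg I). b \<oplus>\<^bsub>quot_alg I\<^esub> a = \<zero>\<^bsub>quot_alg I\<^esub>"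
        by (intro bexI[of _ "cls I (- f)"]) (auto simp: simps carrier_quot_alg)
    qed (auto simp: simps carrier_quot_alg ac_simps)
  qed (auto simp: simps carrier_quot_alg distrib_left distrib_right single_add mult_single
      simp flip: mult.assoc)
  then show ?thesis
    by (rule vector_space_record.intro)
qed

lemma finsum_quot_alg:
  fixes I :: "('n, 'k::field) octant_poly set"
  assumes "ideal I octant_ring" "finite J"
  shows "finsum (quot_alg I) (\<lambda>i. cls I (f i)) J = cls I (\<Sum>i\<in>J. f i)"
proof -
  interpret vector_space_record "quot_alg I"
    by (rule quot_alg_vector_space[OF assms(1)])
  have closed: "(\<lambda>i. cls I (f i)) \<in> K \<rightarrow> carrier (quot_alg I)" for K
    by (auto simp: carrier_quot_alg)
  show ?thesis
    using assms(2)
  proof (induction J rule: finite_induct)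
    case empty
    then show ?case by (simp add: quot_alg_simps[OF assms(1)])
  next
    case (insert i J)
    then show ?case
      using M.finsum_insert[OF insert(1,2) closed] by (simp add: carrier_quot_alg quot_alg_simps[OF assms(1)])
  qed
qed

text \<open>
  Two classes are equal iff the polynomials have the same coefficients outside the support, so these
  coefficients are the coordinates of a class.
\<close>

lemma quot_alg_monomial_basis:
  fixes I :: "('n, 'k::field) octant_poly set"
  assumes I: "monomial_ideal I" and ms: "distinct ms" "set ms = UNIV - ideal_supp I"
  defines "bs \<equiv> map (\<lambda>m. cls I (monomial m)) ms"
  shows "alg_basis (quot_alg I) bs"
    and "basis_coords (quot_alg I) bs (cls I f) =
      vec (length ms) (\<lambda>i. Poly_Mapping.lookup f (ms ! i))"
proof -
  note ideal = monomial_ideal_is_ideal[OF I]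
  let ?p = "\<lambda>v :: 'k vec. \<Sum>i<length ms. Poly_Mapping.single (ms ! i) (v $ i)"
  let ?v = "\<lambda>f. vec (length ms) (\<lambda>i. Poly_Mapping.lookup f (ms ! i))"
  have len: "length bs = length ms"
    by (simp add: bs_def)
  have comb: "lin_comb (quot_alg I) bs v = cls I (?p v)" for v
  proof -
    have "(v $ i) \<odot>\<^bsub>quot_alg I\<^esub> (bs ! i) = cls I (Poly_Mapping.single (ms ! i) (v $ i))"
      if "i < length ms" for i
      using that by (simp add: bs_def quot_alg_simps[OF ideal] mult_single)
    then have "lin_comb (quot_alg I) bs v =
        finsum (quot_alg I) (\<lambda>i. cls I (Poly_Mapping.single (ms ! i) (v $ i))) {..<length ms}"
      unfolding lin_comb_def len
      by (intro abelian_monoid.finsum_cong'[OF abelian_group.axioms(1)]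
            module.axioms(2)[OF vector_space_record.axioms[OF quot_alg_vector_space[OF ideal]]])
        (auto simp: carrier_quot_alg)
    then show ?thesis
      by (simp add: finsum_quot_alg[OF ideal])
  qed
  have lookup: "Poly_Mapping.lookup (?p v) (ms ! j) = v $ j" if "j < length ms" for v :: "'k vec" and j
  proof -
    have "Poly_Mapping.lookup (?p v) (ms ! j) = (\<Sum>i<length ms. if i = j then v $ j else 0)"
      unfolding lookup_sum using that ms(1)
      by (intro sum.cong) (auto simp: lookup_single when_def nth_eq_iff_index_eq)
    then show ?thesis using that by simp
  qed
  have eq_iff: "cls I f = cls I g \<longleftrightarrow> (\<forall>j<length ms. Poly_Mapping.lookup f (ms ! j) = Poly_Mapping.lookup g (ms ! j))"
    for f g
  proof -
    have "cls I f = cls I g \<longleftrightarrow> (\<forall>m \<in> set ms. Poly_Mapping.lookup f m = Poly_Mapping.lookup g m)"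
      unfolding cls_eq_iff[OF ideal] monomial_ideal_iff_keys[OF I] ms(2)
      by (auto simp: in_keys_iff lookup_minus subset_iff)
    then show ?thesis by (simp add: all_set_conv_all_nth)
  qed
  have rep: "cls I f = lin_comb (quot_alg I) bs (?v f)" for f
    unfolding comb eq_iff
  proof (intro allI impI)
    fix j assume "j < length ms"
    then show "Poly_Mapping.lookup f (ms ! j) = Poly_Mapping.lookup (?p (?v f)) (ms ! j)"
      unfolding lookup[OF \<open>j < length ms\<close>] by simp
  qed
  show basis: "alg_basis (quot_alg I) bs"
    unfolding alg_basis_lin_comb
  proof (intro conjI ballI)
    show "set bs \<subseteq> carrier (quot_alg I)"
      by (auto simp: bs_def carrier_quot_alg)
    fix a assume "a \<in> carrier (quot_alg I)"
    then obtain f where f: "a = cls I f"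
      by (auto simp: carrier_quot_alg)
    show "\<exists>!v. v \<in> carrier_vec (length bs) \<and> a = lin_comb (quot_alg I) bs v"
    proof (rule ex1I)
      show "?v f \<in> carrier_vec (length bs) \<and> a = lin_comb (quot_alg I) bs (?v f)"
        unfolding f using rep len by simp
      fix w assume w: "w \<in> carrier_vec (length bs) \<and> a = lin_comb (quot_alg I) bs w"
      then have "\<forall>j<length ms. Poly_Mapping.lookup f (ms ! j) = w $ j"
        unfolding f comb eq_iff by (auto simp: lookup)
      then show "w = ?v f"
        using w len by (intro eq_vecI) auto
    qed
  qed
  show "basis_coords (quot_alg I) bs (cls I f) = ?v f"
    using rep[of f] by (intro basis_coords_eqI[OF basis]) (auto simp: len carrier_quot_alg)
qed


section \<open>The torus action\<close>

text \<open>
  The action of the torus element with coordinates \<open>c\<close>. It is defined for all \<open>c\<close>, also with zero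
  coordinates, where it is still a ring endomorphism.
\<close>

definition scale :: "('n::finite \<Rightarrow> 'k::field) \<Rightarrow> ('n, 'k) octant_poly \<Rightarrow> ('n, 'k) octant_poly" where
  "scale c f = Poly_Mapping.mapp (\<lambda>m a. mon_eval c m * a) f"

lemma lookup_scale [simp]: "Poly_Mapping.lookup (scale c f) m = mon_eval c m * Poly_Mapping.lookup f m"
  by (simp add: scale_def lookup_mapp when_def in_keys_iff)

lemma scale_zero [simp]: "scale c 0 = 0"
  by (rule poly_mapping_eqI) simp

lemma scale_add: "scale c (f + g) = scale c f + scale c g"
  by (rule poly_mapping_eqI) (simp add: lookup_add distrib_left)

lemma scale_single: "scale c (Poly_Mapping.single m a) = Poly_Mapping.single m (mon_eval c m * a)"
  by (rule poly_mapping_eqI) (simp add: lookup_single when_def)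

lemma scale_one [simp]: "scale c 1 = 1"
  using scale_single[of c 0 1] by simp

lemma scale_mult: "scale c (f * g) = scale c f * scale c g"
proof (induction f rule: octant_poly_induct)
  case (single m a)
  show ?case
  proof (induction g rule: octant_poly_induct)
    case (single m' a')
    then show ?case
      by (simp add: mult_single scale_single mon_eval_add ac_simps)
  qed (simp_all add: distrib_left scale_add)
qed (simp_all add: distrib_right scale_add)

lemma scale_smult: "scale c (Poly_Mapping.single 0 a * f) = Poly_Mapping.single 0 a * scale c f"
  by (simp add: scale_mult scale_single)

lemma scale_scale: "scale c (scale c' f) = scale (\<lambda>x. c x * c' x) f"
  by (rule poly_mapping_eqI) (simp add: mon_eval_mult mult.assoc)

lemma scale_unit [simp]: "scale (\<lambda>x. 1) f = f"
  by (rule poly_mapping_eqI) simp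

lemma scale_in_ideal:
  assumes "monomial_ideal I" "f \<in> I"
  shows "scale c f \<in> I"
  using assms by (auto simp: monomial_ideal_iff_keys in_keys_iff)

text \<open>
  Invertibility of \<open>c\<close> is essential: it gives \<open>scale c ` I = I\<close>, so that the image is a full
  coset and not just a part of one.
\<close>

lemma scale_cls:
  assumes I: "monomial_ideal I" and c: "\<And>x. c x \<noteq> 0"
  shows "scale c ` cls I f = cls I (scale c f)"
proof -
  have "h \<in> scale c ` I" if "h \<in> I" for h
    using that c scale_in_ideal[OF I that, of "\<lambda>x. inverse (c x)"]
    by (intro image_eqI[of _ _ "scale (\<lambda>x. inverse (c x)) h"]) (simp_all add: scale_scale)
  then have "scale c ` I = I"
    using scale_in_ideal[OF I] by auto
  then have "(\<lambda>h. h + scale c f) ` (scale c ` I) = (\<lambda>h. h + scale c f) ` I"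
    by simp
  then show ?thesis
    by (simp add: cls_image image_image scale_add)
qed

text \<open>
  A homomorphism on the lattice is determined by its values on the standard basis vectors.
\<close>

lemma lattice_chars_expand:
  fixes t :: "('n::finite \<Rightarrow>\<^sub>0 int) \<Rightarrow> 'k::field"
  assumes "t \<in> lattice_chars"
  shows "t (Poly_Mapping.map int m) = mon_eval (\<lambda>x. t (Poly_Mapping.single x 1)) m"
proof -
  have nz: "t u \<noteq> 0" and add: "t (u + u') = t u * t u'" for u u'
    using assms by (auto simp: lattice_chars_def)
  have zero: "t 0 = 1"
    using add[of 0 0] nz[of 0] by simp
  have power: "t (Poly_Mapping.single x (int e)) = t (Poly_Mapping.single x 1) ^ e" for x e
    by (induction e) (simp_all add: zero single_add add)
  have sum: "t (\<Sum>x\<in>K. u x) = (\<Prod>x\<in>K. t (u x))" if "finite K" for K :: "'n set" and u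
    using that by (induction K rule: finite_induct) (simp_all add: zero add)
  have "Poly_Mapping.map int m = (\<Sum>x\<in>UNIV. Poly_Mapping.single x (int (Poly_Mapping.lookup m x)))"
    by (rule poly_mapping_eqI) (simp add: lookup_sum lookup_single map.rep_eq when_def sum.delta)
  then show ?thesis
    by (simp add: sum power mon_eval_def)
qed

lemma char_act_scale:
  assumes "t \<in> lattice_chars"
  shows "char_act t = scale (\<lambda>x. t (Poly_Mapping.single x 1))"
  by (rule ext, rule poly_mapping_eqI)
    (simp add: char_act_def lookup_mapp when_def in_keys_iff lattice_chars_expand[OF assms])

text \<open>
  These values can be prescribed freely: integer powers of nonzero elements extend them to the
  whole lattice.
\<close>

lemma lattice_chars_generators:
  "(\<lambda>t x. t (Poly_Mapping.single x 1)) ` lattice_chars = {c :: 'n::finite \<Rightarrow> 'k::field. \<forall>x. c x \<noteq> 0}"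
proof (intro subset_antisym subsetI)
  fix c :: "'n \<Rightarrow> 'k" assume "c \<in> {c. \<forall>x. c x \<noteq> 0}"
  then have c: "c x \<noteq> 0" for x by auto
  define t where "t = (\<lambda>u :: 'n \<Rightarrow>\<^sub>0 int. \<Prod>x\<in>UNIV. c x powi Poly_Mapping.lookup u x)"
  have "t \<in> lattice_chars"
    using c by (simp add: lattice_chars_def t_def lookup_add power_int_add prod.distrib)
  moreover have "c = (\<lambda>x. t (Poly_Mapping.single x 1))"
  proof
    fix x
    have "t (Poly_Mapping.single x 1) = (\<Prod>y\<in>UNIV. if y = x then c x else 1)"
      unfolding t_def by (intro prod.cong) (auto simp: lookup_single)
    then show "c x = t (Poly_Mapping.single x 1)" by simp
  qed
  ultimately show "c \<in> (\<lambda>t x. t (Poly_Mapping.single x 1)) ` lattice_chars"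
    by blast
qed (auto simp: lattice_chars_def)

definition quot_scale ::
    "('n::finite, 'k::field) octant_poly set \<Rightarrow> ('n \<Rightarrow> 'k) \<Rightarrow>
     ('n, 'k) octant_poly set \<Rightarrow> ('n, 'k) octant_poly set" where
  "quot_scale I c = restrict (\<lambda>a. scale c ` a) (carrier (quot_alg I))"

lemma quot_torus_eq: "quot_torus I = quot_scale I ` {c. \<forall>x. c x \<noteq> 0}"
  unfolding quot_torus_def lattice_chars_generators[symmetric] image_image quot_scale_def
  by (intro image_cong) (simp_all add: char_act_scale)

context
  fixes I :: "('n::finite, 'k::field) octant_poly set"
  assumes I: "monomial_ideal I"
begin

lemma ideal_I: "ideal I octant_ring"
  by (rule monomial_ideal_is_ideal[OF I])

lemma quot_scale_cls:
  "(\<And>x. c x \<noteq> 0) \<Longrightarrow> quot_scale I c (cls I f) = cls I (scale c f)"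
  by (simp add: quot_scale_def carrier_quot_alg scale_cls[OF I])

lemma quot_scale_auto:
  assumes c: "\<And>x. c x \<noteq> 0"
  shows "quot_scale I c \<in> alg_auto (quot_alg I)"
proof -
  note simps = quot_alg_simps[OF ideal_I] quot_scale_cls carrier_quot_alg
  have "quot_scale I c \<in> ring_iso (quot_alg I) (quot_alg I)"
  proof (rule ring_iso_memI)
    show "bij_betw (quot_scale I c) (carrier (quot_alg I)) (carrier (quot_alg I))"
      by (rule bij_betw_byWitness[of _ "quot_scale I (\<lambda>x. inverse (c x))"])
        (use c in \<open>auto simp: simps scale_scale\<close>)
  qed (use c in \<open>auto simp: simps scale_add scale_mult\<close>)
  moreover have "quot_scale I c \<in> extensional (carrier (quot_alg I))"
    by (simp add: quot_scale_def)
  ultimately show ?thesis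
    using c by (auto simp: alg_auto_def simps scale_smult)
qed

lemma quot_torus_subset_auto: "quot_torus I \<subseteq> alg_auto (quot_alg I)"
  by (auto simp: quot_torus_eq quot_scale_auto)

text \<open>
  The matrices in the basis of monomials are diagonal with the characters as entries. Fullness says that
  the variables belong to this basis.
\<close>

lemma quot_torus_torus_in:
  assumes full: "full_ideal I" and cofinite: "cofinite_support I"
  shows "torus_in (quot_alg I) (alg_auto (quot_alg I)) (quot_torus I)"
proof -
  obtain ms where ms: "distinct ms" "set ms = UNIV - ideal_supp I"
    using cofinite finite_distinct_list unfolding cofinite_support_def by metis
  let ?bs = "map (\<lambda>m. cls I (monomial m)) ms"
  note basis = quot_alg_monomial_basis[OF I ms]
  have "matrix_in_basis (quot_alg I) ?bs (quot_scale I c) = torus_mat ms c"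
    if "\<And>x. c x \<noteq> 0" for c
    using that ms(1)
    by (intro eq_matI)
      (auto simp: matrix_in_basis_def torus_mat_def quot_scale_cls scale_single basis(2)
        lookup_single when_def nth_eq_iff_index_eq)
  then have "matrix_in_basis (quot_alg I) ?bs ` quot_torus I = torus_mats ms"
    unfolding quot_torus_eq torus_mats_def image_image by (intro image_cong) auto
  moreover have "torus_points (length ms) (torus_mats ms :: 'k mat set)"
    using full by (intro torus_points_torus_mats) (auto simp: ms full_ideal_def)
  ultimately show ?thesis
    unfolding torus_in_def using quot_torus_subset_auto basis(1)
    by (intro conjI exI[of _ ?bs]) auto
qed

lemma auto_cls_zero:
  assumes \<phi>: "\<phi> \<in> alg_auto (quot_alg I)"
  shows "\<phi> (cls I 0) = cls I 0"
proof -
  have carr: "cls I 0 \<in> carrier (quot_alg I)"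
    by (simp add: carrier_quot_alg)
  obtain f where "\<phi> (cls I 0) = cls I f"
    using alg_autoD(1)[OF \<phi> carr] by (auto simp: carrier_quot_alg)
  then show ?thesis
    using alg_autoD(5)[OF \<phi> carr, of 0] by (simp add: quot_alg_simps[OF ideal_I])
qed

text \<open>
  The variables generate the quotient: multiplicativity gives the values on monomials, by induction
  on their total degree, and linearity gives the rest.
\<close>

lemma auto_eq_quot_scale:
  assumes \<phi>: "\<phi> \<in> alg_auto (quot_alg I)" and c: "\<And>x. c x \<noteq> 0"
    and gen: "\<And>x. \<phi> (cls I (monomial (Poly_Mapping.single x 1))) =
      cls I (Poly_Mapping.single (Poly_Mapping.single x 1) (c x))"
  shows "\<phi> = quot_scale I c"
proof -
  note simps = quot_alg_simps[OF ideal_I]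
  have carr: "cls I f \<in> carrier (quot_alg I)" for f
    by (simp add: carrier_quot_alg)
  have add: "\<phi> (cls I (f + g)) = \<phi> (cls I f) \<oplus>\<^bsub>quot_alg I\<^esub> \<phi> (cls I g)" for f g
    using alg_autoD(2)[OF \<phi> carr carr, of f g] by (simp add: simps)
  have mult: "\<phi> (cls I (f * g)) = \<phi> (cls I f) \<otimes>\<^bsub>quot_alg I\<^esub> \<phi> (cls I g)" for f g
    using alg_autoD(3)[OF \<phi> carr carr, of f g] by (simp add: simps)
  have smult: "\<phi> (cls I (Poly_Mapping.single 0 a * f)) = a \<odot>\<^bsub>quot_alg I\<^esub> \<phi> (cls I f)" for a f
    using alg_autoD(5)[OF \<phi> carr, of a f] by (simp add: simps)
  have mono: "\<phi> (cls I (monomial m)) = cls I (Poly_Mapping.single m (mon_eval c m))" for m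
  proof (induction "\<Sum>x\<in>UNIV. Poly_Mapping.lookup m x" arbitrary: m)
    case 0
    then have "m = 0"
      by (intro poly_mapping_eqI) simp
    then show ?case
      using alg_autoD(4)[OF \<phi>] by (simp add: simps)
  next
    case (Suc N)
    have "(\<Sum>x\<in>UNIV. Poly_Mapping.lookup m x) \<noteq> 0"
      using Suc.hyps(2) by linarith
    then obtain x where x: "Poly_Mapping.lookup m x \<noteq> 0"
      by (rule sum.not_neutral_contains_not_neutral)
    let ?e = "Poly_Mapping.single x (1::nat)"
    \<comment> \<open>The subtraction of exponents is truncated; it is exact because \<open>x\<close> occurs in \<open>m\<close>.\<close>
    have m: "m = (m - ?e) + ?e"
      using x by (intro poly_mapping_eqI) (auto simp: lookup_add lookup_minus lookup_single when_def)
    have "(\<Sum>y\<in>UNIV. Poly_Mapping.lookup m y) =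
        (\<Sum>y\<in>UNIV. Poly_Mapping.lookup (m - ?e) y) + (\<Sum>y\<in>UNIV. Poly_Mapping.lookup ?e y)"
      by (subst m) (simp add: lookup_add sum.distrib)
    also have "(\<Sum>y\<in>UNIV. Poly_Mapping.lookup ?e y) = 1"
      by (simp add: lookup_single when_def)
    finally have "N = (\<Sum>y\<in>UNIV. Poly_Mapping.lookup (m - ?e) y)"
      using Suc.hyps(2) by simp
    from Suc.hyps(1)[OF this]
    have "\<phi> (cls I (monomial ((m - ?e) + ?e))) =
        cls I (Poly_Mapping.single ((m - ?e) + ?e) (mon_eval c ((m - ?e) + ?e)))"
      using mult[of "monomial (m - ?e)" "monomial ?e"]
      by (simp add: mult_single gen[unfolded One_nat_def] simps mon_eval_add)
    then show ?case
      by (simp only: m[symmetric])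
  qed
  have "\<phi> (cls I f) = cls I (scale c f)" for f
  proof (induction f rule: octant_poly_induct)
    case zero
    then show ?case
      by (simp add: auto_cls_zero[OF \<phi>])
  next
    case (single m a)
    then show ?case
      using smult[of a "monomial m"] mono[of m]
      by (simp add: mult_single simps scale_single mult.commute)
  next
    case (add f g)
    then show ?case
      using \<open>\<And>f g. \<phi> (cls I (f + g)) = \<phi> (cls I f) \<oplus>\<^bsub>quot_alg I\<^esub> \<phi> (cls I g)\<close>[of f g]
      by (simp add: simps scale_add)
  qed
  then show ?thesis
    using alg_autoD(6)[OF \<phi>] alg_autoD(6)[OF quot_scale_auto[OF c]]
    by (intro extensionalityI[where A = "carrier (quot_alg I)"])
      (auto simp only: carrier_quot_alg quot_scale_cls[OF c])
qed

end


section \<open>The centralizer of the torus\<close>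

text \<open>
  For the nontrivial inclusion, commutation with \<open>T\<close> forces the image of a variable to have the weight of
  that variable.
\<close>

lemma centralizer_quot_torus:
  fixes I :: "('n::finite, 'k::field_char_0) octant_poly set"
  assumes I: "monomial_ideal I" and full: "full_ideal I"
  shows "centralizer (alg_AutoGroup (quot_alg I)) (quot_torus I) = quot_torus I"
proof (intro subset_antisym subsetI)
  fix \<phi> assume "\<phi> \<in> quot_torus I"
  then show "\<phi> \<in> centralizer (alg_AutoGroup (quot_alg I)) (quot_torus I)"
    unfolding centralizer_def using quot_torus_subset_auto[OF I]
    by (auto simp: quot_torus_eq quot_scale_auto[OF I]
        alg_AutoGroup_commute_iff carrier_quot_alg quot_scale_cls[OF I] scale_scale mult.commute)
next
  fix \<phi> assume "\<phi> \<in> centralizer (alg_AutoGroup (quot_alg I)) (quot_torus I)"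
  then have \<phi>: "\<phi> \<in> alg_auto (quot_alg I)"
    and comm: "\<And>c a. (\<And>x. c x \<noteq> 0) \<Longrightarrow> a \<in> carrier (quot_alg I) \<Longrightarrow>
      \<phi> (quot_scale I c a) = quot_scale I c (\<phi> a)"
    by (auto simp: centralizer_def quot_torus_eq alg_AutoGroup_commute_iff quot_scale_auto[OF I])
  note ideal = ideal_I[OF I]
  note simps = quot_alg_simps[OF ideal]
  have carr: "cls I f \<in> carrier (quot_alg I)" for f
    by (simp add: carrier_quot_alg)
  note zero = auto_cls_zero[OF I \<phi>]
  have "\<exists>a. a \<noteq> 0 \<and> \<phi> (cls I (monomial (Poly_Mapping.single x 1))) =
      cls I (Poly_Mapping.single (Poly_Mapping.single x 1) a)" for x
  proof -
    let ?e = "Poly_Mapping.single x (1::nat)"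
    obtain f where f: "\<phi> (cls I (monomial ?e)) = cls I f"
      using alg_autoD(1)[OF \<phi> carr, of "monomial ?e"] by (auto simp: carrier_quot_alg)
    have weight: "m = ?e" if m: "m \<notin> ideal_supp I" "Poly_Mapping.lookup f m \<noteq> 0" for m
    proof (rule poly_mapping_eqI)
      fix y
      \<comment> \<open>The torus element that detects the exponent at \<open>y\<close>.\<close>
      define c where "c = (\<lambda>z :: 'n. if z = y then 2 else 1 :: 'k)"
      have c: "c z \<noteq> 0" for z by (simp add: c_def)
      have eval: "mon_eval c u = 2 ^ Poly_Mapping.lookup u y" for u
      proof -
        have "mon_eval c u = (\<Prod>z\<in>UNIV. if z = y then 2 ^ Poly_Mapping.lookup u y else 1)"
          unfolding mon_eval_def c_def by (intro prod.cong) auto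
        then show ?thesis by simp
      qed
      have "cls I (scale c f) = quot_scale I c (\<phi> (cls I (monomial ?e)))"
        unfolding f by (rule quot_scale_cls[OF I c, symmetric])
      also have "\<dots> = \<phi> (quot_scale I c (cls I (monomial ?e)))"
        by (rule comm[OF c carr, symmetric])
      also have "quot_scale I c (cls I (monomial ?e)) = mon_eval c ?e \<odot>\<^bsub>quot_alg I\<^esub> cls I (monomial ?e)"
        by (simp add: quot_scale_cls[OF I c] scale_single simps mult_single del: mon_eval_single)
      also have "\<phi> \<dots> = cls I (Poly_Mapping.single 0 (mon_eval c ?e) * f)"
        unfolding alg_autoD(5)[OF \<phi> carr] f by (rule simps(3))
      finally have "scale c f - Poly_Mapping.single 0 (mon_eval c ?e) * f \<in> I"
        by (simp add: cls_eq_iff[OF ideal] del: mon_eval_single)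
      then have "Poly_Mapping.lookup (scale c f - Poly_Mapping.single 0 (mon_eval c ?e) * f) m = 0"
        using m(1) by (auto simp: monomial_ideal_iff_keys[OF I] in_keys_iff)
      moreover have "Poly_Mapping.lookup (Poly_Mapping.single 0 a * f) m = a * Poly_Mapping.lookup f m" for a
        by (simp add: map.rep_eq when_def flip: mult_map_scale_conv_mult)
      ultimately have "mon_eval c m = mon_eval c ?e"
        using m(2) by (simp add: lookup_minus del: mon_eval_single)
      then have "(2::'k) ^ Poly_Mapping.lookup m y = 2 ^ Poly_Mapping.lookup ?e y"
        unfolding eval .
      then have "(of_nat (2 ^ Poly_Mapping.lookup m y) :: 'k) = of_nat (2 ^ Poly_Mapping.lookup ?e y)"
        by simp
      then have "(2::nat) ^ Poly_Mapping.lookup m y = 2 ^ Poly_Mapping.lookup ?e y"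
        unfolding of_nat_eq_iff .
      then show "Poly_Mapping.lookup m y = Poly_Mapping.lookup ?e y"
        by simp
    qed
    let ?a = "Poly_Mapping.lookup f ?e"
    have "Poly_Mapping.keys (f - Poly_Mapping.single ?e ?a) \<subseteq> ideal_supp I"
    proof (rule subsetI, rule ccontr)
      fix m assume "m \<in> Poly_Mapping.keys (f - Poly_Mapping.single ?e ?a)" "m \<notin> ideal_supp I"
      moreover from this have "Poly_Mapping.lookup f m \<noteq> 0"
        by (auto simp: in_keys_iff lookup_minus lookup_single when_def split: if_splits)
      ultimately show False
        using weight by (auto simp: in_keys_iff lookup_minus)
    qed
    then have image: "\<phi> (cls I (monomial ?e)) = cls I (Poly_Mapping.single ?e ?a)"
      unfolding f cls_eq_iff[OF ideal] monomial_ideal_iff_keys[OF I] .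
    \<comment> \<open>Fullness enters here: the class of the variable is not zero, hence neither is its image.\<close>
    have "?a \<noteq> 0"
    proof
      assume "?a = 0"
      then have "\<phi> (cls I (monomial ?e)) = \<phi> (cls I 0)"
        using image zero by simp
      then have "cls I (monomial ?e) = cls I 0"
        using alg_autoD(7)[OF \<phi>] carr by (auto simp: bij_betw_def inj_on_def)
      then have "?e \<in> ideal_supp I"
        by (simp add: cls_eq_iff[OF ideal] ideal_supp_def)
      then show False
        using full by (simp add: full_ideal_def)
    qed
    with image show ?thesis by blast
  qed
  then have "\<exists>c. \<forall>x. c x \<noteq> 0 \<and> \<phi> (cls I (monomial (Poly_Mapping.single x 1))) =
      cls I (Poly_Mapping.single (Poly_Mapping.single x 1) (c x))"
    by (intro choice) blast
  then obtain c where c: "\<And>x. c x \<noteq> 0" "\<And>x. \<phi> (cls I (monomial (Poly_Mapping.single x 1))) =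
      cls I (Poly_Mapping.single (Poly_Mapping.single x 1) (c x))"
    by blast
  have "\<phi> = quot_scale I c"
    by (rule auto_eq_quot_scale[OF I \<phi> c])
  then show "\<phi> \<in> quot_torus I"
    using c(1) by (auto simp: quot_torus_eq)
qed

theorem lemma4p5:
  fixes I :: "('n::finite, 'k::field_char_0) octant_poly set"
  assumes "monomial_ideal I" and "full_ideal I" and "cofinite_support I"
  shows "centralizer (alg_AutoGroup (quot_alg I)) (quot_torus I) = quot_torus I \<and>
         maximal_torus_in (quot_alg I) (carrier (alg_AutoGroup (quot_alg I))) (quot_torus I)"
proof -
  interpret vector_space_record "quot_alg I"
    by (rule quot_alg_vector_space[OF monomial_ideal_is_ideal[OF assms(1)]])
  show ?thesis
    using centralizer_quot_torus[OF assms(1,2)] quot_torus_torus_in[OF assms]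
    by (simp add: self_centralizing_torus_maximal)
qed

end
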